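(* Let $q$ be a prime power, let $n$ be a positive integer, and let $\sigma$ be a positive real number with $$\sigma\leqslant q^{-2\lfloor \frac{n-1}{2}\rfloor-1} = \begin{cases} q^{-n}&\text{if $n$ is odd,}\\ q^{-n+1}&\text{if $n$ is even.}\end{cases}$$ If a family $U\subset\Omega_n$ of subspaces of $\mathbb{F}_q^n$ is intersecting, then $$\mu_{\sigma}(U)\leqslant\frac{\sigma}{1+\sigma}.$$ Moreover, if $U\subset\Omega_n$ is intersecting with $\mu_{\sigma}(U)=\frac{\sigma}{1+\sigma}$ and if $\sigma< q^{-2\lfloor \frac{n-1}{2}\rfloor-1}$, then there exists a one-dimensional subspace $y$ of $\mathbb{F}_q^n$ such that $$U=\{x\in\Omega_n : y\subset x\}.$$
   Context: $\mathbb{F}_q$ is the field with $q$ elements and $\Omega_n$ is the set of all subspaces of the $n$-dimensional vector space $\mathbb{F}_q^n$. A family $U\subset\Omega_n$ is called intersecting if $x\cap y\neq 0$ for all $x,y\in U$ (including $x=y$, so an intersecting family does not contain the zero subspace). For a real number $\sigma>0$ and $0\leqslant k\leqslant n$, put $$\phi_{\sigma,n}(k):=\frac{\sigma^{k}q^{\binom{k}{2}}}{(-\sigma;q)_n},\qquad (-\sigma;q)_n:=\prod_{j=0}^{n-1}(1+\sigma q^j).$$ The $\sigma$-biased (probability) measure $\mu_\sigma$ on $\Omega_n$ is defined by $\mu_{\sigma}(U):=\sum_{x\in U}\phi_{\sigma,n}(\dim x)$ for $U\subset\Omega_n$. *)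

theory Defs
  imports "HOL-Analysis.Analysis"
begin

text \<open>
  The field with \<open>q\<close> elements is a type \<open>'a :: {field, finite}\<close> with \<open>q = CARD('a)\<close>, and
  \<open>n\<close>-dimensional space over it is \<open>'a ^ 'n\<close> with \<open>n = CARD('n)\<close>. Subspaces and
  dimensions are those of the vector space structure \<^const>\<open>vector_scalar_mult\<close>.
\<close>

definition Omega :: "('a :: {field, finite} ^ 'n) set set" where
  "Omega = {x. vec.subspace x}"

text \<open>Taking \<open>x = y\<close> excludes the zero subspace.\<close>

definition intersecting :: "('a :: {field, finite} ^ 'n) set set \<Rightarrow> bool" where
  "intersecting U \<longleftrightarrow> (\<forall>x\<in>U. \<forall>y\<in>U. x \<inter> y \<noteq> {0})"

text \<open>\<open>qpoch a q n\<close> is the \<open>q\<close>-shifted factorial \<open>(a; q)\<close> with index \<open>n\<close>.\<close>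

definition qpoch :: "real \<Rightarrow> real \<Rightarrow> nat \<Rightarrow> real" where
  "qpoch a q n = (\<Prod>j<n. 1 - a * q ^ j)"

lemma qpoch_uminus: "qpoch (- s) q n = (\<Prod>j<n. 1 + s * q ^ j)"
  by (simp add: qpoch_def)

definition phi :: "nat \<Rightarrow> real \<Rightarrow> nat \<Rightarrow> nat \<Rightarrow> real" where
  "phi q \<sigma> n k = \<sigma> ^ k * real q ^ (k choose 2) / qpoch (- \<sigma>) (real q) n"

definition mu :: "real \<Rightarrow> ('a :: {field, finite} ^ 'n) set set \<Rightarrow> real" where
  "mu \<sigma> U = (\<Sum>x\<in>U. phi CARD('a) \<sigma> CARD('n) (vec.dim x))"

definition sigma_bound :: "nat \<Rightarrow> nat \<Rightarrow> real" where
  "sigma_bound q n = real q powi (- 2 * \<lfloor>(real n - 1) / 2\<rfloor> - 1)"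

lemma sigma_bound_cases:
  "sigma_bound q n = (if odd n then real q powi (- int n) else real q powi (- int n + 1))"
proof (cases "odd n")
  case True
  then obtain m where m: "n = 2 * m + 1" by (elim oddE)
  have "\<lfloor>(real n - 1) / 2\<rfloor> = int m" by (simp add: m)
  then have "- 2 * \<lfloor>(real n - 1) / 2\<rfloor> - 1 = - int n" by (simp add: m)
  then show ?thesis using True by (simp only: sigma_bound_def if_True not_False_eq_True)
next
  case False
  then obtain m where m: "n = 2 * m" by auto
  have "\<lfloor>(real n - 1) / 2\<rfloor> = int m - 1" by (simp add: m floor_eq_iff)
  then have "- 2 * \<lfloor>(real n - 1) / 2\<rfloor> - 1 = - int n + 1" by (simp add: m)
  then show ?thesis using False by (simp only: sigma_bound_def if_False not_True_eq_False)
qed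

end

theory Submission
  imports "HOL-Algebra.Algebraic_Closure_Type" Defs
begin

text \<open>
Write \<open>V\<close> for the \<open>n\<close>-dimensional space, and call the family of all subspaces through a fixed line a
star; stars have measure \<open>\<sigma> / (1 + \<sigma>)\<close>. The proof averages over partitions of \<open>V\<close>. Suppose that a set
of subspaces covers \<open>V\<close> and that any two of them meet only in \<open>0\<close>. Of the images of these subspaces
under a linear automorphism of \<open>V\<close>, an intersecting family contains at most one, and a star contains
exactly one. Averaging over all automorphisms (\<open>sum_density_le_1\<close>) gives a linear inequality between
the proportions of subspaces of each dimension that belong to the family, with equality for stars.

For \<open>0 < k \<le> n / 2\<close> there is such a partition into one subspace \<open>Y\<close> of dimension \<open>n - k\<close> and
\<open>q ^ (n - k)\<close> subspaces of dimension \<open>k\<close>, built from multiplication in the field with \<open>q ^ (n - k)\<close>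
elements (\<open>exists_partial_spread\<close>). A second partition arises on replacing \<open>Y\<close> by its lines. Let \<open>\<delta> k\<close> be
the proportion of \<open>k\<close>-dimensional subspaces in the family minus the proportion for a star. The two
partitions give
\<open>q ^ (n - k) * \<delta> k + \<delta> (n - k) \<le> 0\<close> and \<open>q ^ (n - k) * \<delta> k + (q ^ (n - k) - 1) / (q - 1) * \<delta> 1 \<le> 0\<close>,
and trivial partitions give \<open>\<delta> 1 \<le> 0\<close> and \<open>\<delta> n \<le> 0\<close> (\<open>density_bounds\<close>).

Let \<open>T k\<close> be the unnormalised measure of the set of all \<open>k\<close>-dimensional subspaces. Up to a positive
factor, \<open>\<Sum>k. T k * \<delta> k\<close> is the measure of the family minus that of a star (\<open>mu_eq_sum_density\<close>,
\<open>sum_level_mass_star\<close>). The bound on \<open>\<sigma>\<close> implies \<open>q ^ (n - k) * T (n - k) \<le> T k\<close> for \<open>0 < k < n / 2\<close>. So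
the first inequality disposes of the levels above \<open>n / 2\<close>, and the second one transfers what is left on the
levels \<open>2 \<le> k < n / 2\<close> to the level of lines. The masses \<open>T k\<close> decay fast enough for level 1 to pay for
all of this, and the sum is at most a nonnegative multiple of \<open>\<delta> 1\<close> (\<open>weighted_deviation_le_0\<close>).

If \<open>\<sigma>\<close> is strictly below the bound, that multiple is positive. Equality then forces \<open>\<delta> 1 = 0\<close>, so the
family contains a line \<open>y\<close>. All its members meet \<open>y\<close> and hence contain it. As the star of \<open>y\<close> cannot have
larger measure and every subspace has positive measure, the family is the whole star.
\<close>

section \<open>The field with \<open>q ^ m\<close> elements inside the algebraic closure\<close>

lemma pow_card_eq_self:
  fixes x :: "'a :: {field, finite}"
  shows "x ^ CARD('a) = x"
proof (cases "x = 0")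
  case False
  have "x * (\<Prod>y\<in>UNIV-{0}. x * y) = x * x ^ (CARD('a) - 1) * \<Prod>(UNIV-{0})"
    by (simp add: prod.distrib mult_ac)
  also have "x * x ^ (CARD('a) - 1) = x ^ CARD('a)"
    by (subst power_Suc [symmetric]) auto
  also have "(\<Prod>y\<in>UNIV-{0}. x * y) = (\<Prod>y\<in>UNIV-{0}. y)"
    by (rule prod.reindex_bij_witness[of _ "\<lambda>y. y / x" "\<lambda>y. x * y"]) (use False in auto)
  finally show ?thesis
    by simp
qed auto

lemma of_nat_card_field: "of_nat CARD('a) = (0 :: 'a :: {field, finite})"
proof -
  have "(\<Sum>x\<in>UNIV. x) = (\<Sum>x\<in>UNIV. x + 1 :: 'a)"
    by (rule sum.reindex_bij_witness[of _ "\<lambda>y. y + 1" "\<lambda>y. y - 1"]) auto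
  also have "\<dots> = (\<Sum>x\<in>UNIV. x) + of_nat CARD('a)"
    by (simp add: sum.distrib)
  finally show ?thesis by simp
qed

lemma card_field_gt_1: "CARD('a :: {field, finite}) > 1"
proof -
  have "card {0, 1 :: 'a} \<le> CARD('a)"
    by (rule card_mono) auto
  then show ?thesis by simp
qed

text \<open>
Both sides are monic of degree \<open>q\<close> in \<open>y\<close> and vanish at the \<open>q\<close> elements of the ground field.
\<close>

lemma pow_card_diff_eq_prod:
  fixes y :: "'a :: {field, finite} alg_closure"
  shows "y ^ CARD('a) - y = (\<Prod>c\<in>(UNIV :: 'a set). y - to_ac c)"
proof -
  define P where "P = monom 1 CARD('a) - [:0, 1 :: 'a alg_closure:]"
  define R where "R = (\<Prod>c\<in>(UNIV :: 'a set). [:- to_ac c, 1:])"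
  have q: "CARD('a) > 1" by (rule card_field_gt_1)
  have degP: "degree P \<le> CARD('a)"
    unfolding P_def by (rule degree_diff_le) (use q in \<open>auto simp: degree_monom_eq\<close>)
  have coeffP: "coeff P CARD('a) = 1"
    unfolding P_def using q by (simp add: coeff_pCons split: nat.splits)
  have degR: "degree R = CARD('a)"
    unfolding R_def by (subst degree_prod_eq_sum_degree) auto
  have coeffR: "coeff R CARD('a) = 1"
    unfolding degR [symmetric] unfolding R_def by (subst lead_coeff_prod) simp
  have "P = R"
  proof (rule poly_eqI_degree_lead_coeff)
    show "coeff P CARD('a) = coeff R CARD('a)" by (simp add: coeffP coeffR)
    show "CARD('a) \<le> card (range (to_ac :: 'a \<Rightarrow> _))"
      by (simp add: card_image inj_to_ac)
    fix z assume "z \<in> range (to_ac :: 'a \<Rightarrow> _)"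
    then obtain c :: 'a where c: "z = to_ac c" by auto
    have "poly P z = 0"
      by (simp add: P_def c poly_monom pow_card_eq_self flip: to_ac_power)
    moreover have "poly R z = 0"
      by (auto simp: R_def c poly_prod)
    ultimately show "poly P z = poly R z" by simp
  qed (use degP degR in auto)
  then have "poly P y = poly R y" by simp
  then show ?thesis by (simp add: P_def R_def poly_prod poly_monom)
qed

text \<open>
This avoids showing that \<open>q\<close> is a power of the characteristic. For \<open>x\<close> in the ground field the
identity holds because translation by \<open>x\<close> permutes the factors of \<open>y ^ q - y\<close>. For fixed \<open>y\<close> both
sides are monic polynomials of degree \<open>q\<close> in \<open>x\<close>, so agreement on the \<open>q\<close> elements of the ground
field extends to all \<open>x\<close>.
\<close>

lemma pow_card_add:
  fixes x y :: "'a :: {field, finite} alg_closure"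
  shows "(x + y) ^ CARD('a) = x ^ CARD('a) + y ^ CARD('a)"
proof -
  have q: "CARD('a) > 1" by (rule card_field_gt_1)
  have shift: "(to_ac c + y) ^ CARD('a) = to_ac c + y ^ CARD('a)" for c :: 'a
  proof -
    have "(to_ac c + y) ^ CARD('a) - (to_ac c + y) = (\<Prod>d\<in>(UNIV :: 'a set). to_ac c + y - to_ac d)"
      by (rule pow_card_diff_eq_prod)
    also have "\<dots> = (\<Prod>d\<in>(UNIV :: 'a set). y - to_ac d)"
      by (rule prod.reindex_bij_witness[of _ "\<lambda>d. d + c" "\<lambda>d. d - c"]) auto
    also have "\<dots> = y ^ CARD('a) - y"
      by (rule pow_card_diff_eq_prod [symmetric])
    finally show ?thesis by (simp add: algebra_simps)
  qed
  define P where "P = [:y, 1:] ^ CARD('a)"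
  define R where "R = monom 1 CARD('a) + [:y ^ CARD('a):]"
  have degP: "degree P = CARD('a)"
    unfolding P_def by (simp add: degree_power_eq)
  have coeffP: "coeff P CARD('a) = 1"
    unfolding degP [symmetric] unfolding P_def by (simp add: lead_coeff_power)
  have "P = R"
  proof (rule poly_eqI_degree_lead_coeff)
    show "coeff P CARD('a) = coeff R CARD('a)"
      using q by (simp add: coeffP R_def coeff_pCons split: nat.splits)
    show "CARD('a) \<le> card (range (to_ac :: 'a \<Rightarrow> _))"
      by (simp add: card_image inj_to_ac)
    show "degree R \<le> CARD('a)"
      unfolding R_def by (rule degree_add_le) (use q in \<open>auto simp: degree_monom_eq\<close>)
    fix z assume "z \<in> range (to_ac :: 'a \<Rightarrow> _)"
    then obtain c :: 'a where c: "z = to_ac c" by auto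
    then show "poly P z = poly R z"
      using shift [of c]
      by (simp add: P_def R_def poly_monom poly_power pow_card_eq_self algebra_simps
          flip: to_ac_power)
  qed (use degP in auto)
  then have "poly P x = poly R x" by simp
  then show ?thesis by (simp add: P_def R_def poly_monom poly_power add.commute)
qed

lemma pow_card_pow_add:
  fixes x y :: "'a :: {field, finite} alg_closure"
  shows "(x + y) ^ (CARD('a) ^ m) = x ^ (CARD('a) ^ m) + y ^ (CARD('a) ^ m)"
  by (induction m) (simp_all add: power_mult pow_card_add mult.commute [of "CARD('a)"])

lemma card_roots_eq_degree:
  fixes p :: "'a :: alg_closed_field poly"
  assumes p: "p \<noteq> 0" and simple: "\<And>x. poly p x = 0 \<Longrightarrow> poly (pderiv p) x \<noteq> 0"
  shows "card {x. poly p x = 0} = degree p"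
proof -
  obtain A where A: "size A = degree p" "p = smult (lead_coeff p) (\<Prod>x\<in>#A. [:-x, 1:])"
    using alg_closed_imp_factorization[OF p] by blast
  have lc: "lead_coeff p \<noteq> 0" using p by simp
  have "poly (\<Prod>x\<in>#B. [:-x, 1:]) y = 0 \<longleftrightarrow> y \<in># B" for B and y :: 'a
    by (induction B) auto
  then have root_iff: "poly p x = 0 \<longleftrightarrow> x \<in># A" for x
    using lc by (metis A(2) mult_eq_0_iff poly_smult)
  have count: "count A x \<le> 1" for x
  proof (rule ccontr)
    assume "\<not> count A x \<le> 1"
    then have "x \<in># A" by (rule contrapos_np) (simp add: not_in_iff)
    then obtain C where C: "A = add_mset x C" by (blast dest: multi_member_split)
    have "x \<in># C"
      using \<open>\<not> count A x \<le> 1\<close> by (rule contrapos_np) (simp add: C not_in_iff)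
    then obtain B where B: "A = add_mset x (add_mset x B)"
      using C by (blast dest: multi_member_split)
    have "p = [:-x, 1:] * ([:-x, 1:] * smult (lead_coeff p) (\<Prod>x\<in>#B. [:-x, 1:]))"
      (is "_ = _ * (_ * ?r)")
      by (subst A(2)) (simp add: B)
    then obtain r where r: "p = [:-x, 1:] * ([:-x, 1:] * r)" by blast
    have "poly [:-x, 1:] x = 0" by simp
    then have "poly p x = 0" "poly (pderiv p) x = 0"
      by (simp_all only: r pderiv_mult poly_mult poly_add mult_zero_left mult_zero_right add_0)
    then show False using simple by blast
  qed
  have "A = mset_set (set_mset A)"
  proof (rule multiset_eqI)
    fix x
    show "count A x = count (mset_set (set_mset A)) x"
    proof (cases "x \<in># A")
      case True
      then have "count A x > 0" by simp
      with count [of x] have "count A x = 1" by linarith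
      then show ?thesis using True by simp
    qed (simp add: not_in_iff)
  qed
  then have "size A = card (set_mset A)"
    by (metis size_mset_set)
  moreover have "set_mset A = {x. poly p x = 0}" using root_iff by auto
  ultimately show ?thesis using A(1) by simp
qed

definition subfield_roots :: "nat \<Rightarrow> 'a :: {field, finite} alg_closure set" where
  "subfield_roots m = {x. x ^ (CARD('a) ^ m) = x}"

text \<open>
The derivative of \<open>X ^ (q ^ m) - X\<close> is \<open>- 1\<close>, so all roots of this polynomial are simple.
\<close>

lemma card_subfield_roots:
  assumes "m > 0"
  shows "card (subfield_roots m :: 'a :: {field, finite} alg_closure set) = CARD('a) ^ m"
proof -
  define Q where "Q = CARD('a) ^ m"
  define p where "p = monom 1 Q - [:0, 1 :: 'a alg_closure:]"
  have Q: "Q > 1" unfolding Q_def using assms card_field_gt_1[where 'a = 'a] one_less_power by blast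
  have degp: "degree p = Q"
    unfolding p_def diff_conv_add_uminus
    using Q by (subst degree_add_eq_left) (auto simp: degree_monom_eq)
  then have p0: "p \<noteq> 0" using Q by auto
  have "of_nat CARD('a) = (0 :: 'a alg_closure)"
    by (metis of_nat_card_field to_ac_of_nat to_ac_0)
  then have Q0: "of_nat Q = (0 :: 'a alg_closure)"
    using assms by (simp add: Q_def)
  have "card {x. poly p x = 0} = degree p"
  proof (rule card_roots_eq_degree[OF p0])
    fix x
    show "poly (pderiv p) x \<noteq> 0"
      by (simp add: p_def pderiv_diff pderiv_monom pderiv_pCons Q0)
  qed
  moreover have "{x. poly p x = 0} = subfield_roots m"
    by (simp add: p_def subfield_roots_def poly_monom Q_def)
  ultimately show ?thesis by (simp add: degp Q_def)
qed

lemma subfield_roots_add: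
  "x \<in> subfield_roots m \<Longrightarrow> y \<in> subfield_roots m \<Longrightarrow> x + y \<in> subfield_roots m"
  by (simp add: subfield_roots_def pow_card_pow_add)

lemma subfield_roots_mult:
  "x \<in> subfield_roots m \<Longrightarrow> y \<in> subfield_roots m \<Longrightarrow> x * y \<in> subfield_roots m"
  by (simp add: subfield_roots_def power_mult_distrib)

lemma to_ac_in_subfield_roots: "to_ac c \<in> subfield_roots m"
proof -
  have "c ^ (CARD('a) ^ m) = c" for c :: "'a :: {field, finite}"
    by (induction m) (simp_all add: power_mult pow_card_eq_self)
  then show ?thesis by (simp add: subfield_roots_def flip: to_ac_power)
qed

section \<open>Partial spreads\<close>

lemma (in vector_space) card_span_independent:
  assumes "finite (UNIV :: 'a set)" "finite B" "independent B"
  shows "card (span B) = CARD('a) ^ card B"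
proof -
  let ?h = "\<lambda>u. \<Sum>v\<in>B. scale (u v) v"
  have "span B = ?h ` (B \<rightarrow>\<^sub>E UNIV)"
  proof -
    have "range ?h \<subseteq> ?h ` (B \<rightarrow>\<^sub>E UNIV)"
    proof
      fix x assume "x \<in> range ?h"
      then obtain u where "x = ?h u" by auto
      then show "x \<in> ?h ` (B \<rightarrow>\<^sub>E UNIV)"
        by (intro image_eqI [where x = "restrict u B"]) simp_all
    qed
    then have "range ?h = ?h ` (B \<rightarrow>\<^sub>E UNIV)" by blast
    then show ?thesis by (simp add: span_finite assms)
  qed
  moreover have "inj_on ?h (B \<rightarrow>\<^sub>E UNIV)"
  proof (rule inj_onI)
    fix u w assume u: "u \<in> B \<rightarrow>\<^sub>E UNIV" and w: "w \<in> B \<rightarrow>\<^sub>E UNIV" and eq: "?h u = ?h w"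
    have "(\<Sum>v\<in>B. scale (u v - w v) v) = 0"
      using eq by (simp add: scale_left_diff_distrib sum_subtractf)
    then have "u v - w v = 0" if "v \<in> B" for v
      using independentD[OF assms(3,2) order_refl, of "\<lambda>v. u v - w v" v] that by simp
    then show "u = w" using u w by (intro PiE_ext) auto
  qed
  ultimately show ?thesis
    using assms by (simp add: card_image card_PiE)
qed

lemma card_subspace:
  fixes S :: "('a :: {field, finite} ^ 'n) set"
  assumes "vec.subspace S"
  shows "card S = CARD('a) ^ vec.dim S"
proof -
  obtain B where B: "B \<subseteq> S" "vec.independent B" "S \<subseteq> vec.span B" "card B = vec.dim S"
    by (rule vec.basis_exists)
  then have "S = vec.span B" using assms vec.span_subspace by blast
  then show ?thesis
    using vec.card_span_independent[of B] B vec.finiteI_independent by auto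
qed

lemma dim_eqI_card:
  fixes S :: "('a :: {field, finite} ^ 'n) set"
  assumes "vec.subspace S" "card S = CARD('a) ^ k"
  shows "vec.dim S = k"
  using card_subspace[OF assms(1)] assms(2) card_field_gt_1[where 'a = 'a] by simp

lemma subfield_roots_basis:
  assumes "m > 0"
  obtains B :: "'a :: {field, finite} alg_closure set" where
    "finite B" "card B = m"
    "\<forall>c. (\<Sum>b\<in>B. to_ac (c b) * b) = 0 \<longrightarrow> (\<forall>b\<in>B. c b = 0)"
    "subfield_roots m = range (\<lambda>c. \<Sum>b\<in>B. to_ac (c b) * b)"
proof -
  interpret ac: vector_space "\<lambda>(c :: 'a) x. to_ac c * x"
    by unfold_locales (auto simp: algebra_simps)
  let ?F = "subfield_roots m :: 'a alg_closure set"
  have "0 \<in> ?F"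
    using to_ac_in_subfield_roots[of "0 :: 'a" m] by simp
  then have sub: "ac.subspace ?F"
    by (auto simp: ac.subspace_def subfield_roots_add subfield_roots_mult to_ac_in_subfield_roots)
  have card: "card ?F = CARD('a) ^ m" by (rule card_subfield_roots[OF assms])
  then have fin: "finite ?F"
    using card_field_gt_1[where 'a = 'a] by (intro card_ge_0_finite) simp
  obtain B where B: "B \<subseteq> ?F" "ac.independent B" "?F \<subseteq> ac.span B"
    by (rule ac.maximal_independent_subset)
  have finB: "finite B" using B(1) fin by (rule finite_subset)
  have span: "ac.span B = ?F" using B sub ac.span_subspace by blast
  have "CARD('a) ^ card B = CARD('a) ^ m"
    using ac.card_span_independent[OF _ finB B(2)] by (simp add: span card)
  then have "card B = m" using card_field_gt_1[where 'a = 'a] by simp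
  moreover have "c b = 0" if "(\<Sum>b\<in>B. to_ac (c b) * b) = 0" "b \<in> B" for c b
    using ac.independentD[OF B(2) finB order_refl that] .
  moreover have "?F = range (\<lambda>c. \<Sum>b\<in>B. to_ac (c b) * b)"
    using ac.span_finite[OF finB] span by simp
  ultimately show thesis using that finB by blast
qed

text \<open>
Let \<open>F\<close> be the field with \<open>q ^ m\<close> elements and \<open>K\<close> a \<open>k\<close>-dimensional subspace of \<open>F\<close>. Identify the
whole space with \<open>F \<times> K\<close> through a pair \<open>(f, g)\<close> of linear maps. Take for \<open>Y\<close> the vectors \<open>(s, 0)\<close>
and for the members of \<open>P\<close> the graphs of \<open>t \<mapsto> a * t\<close> on \<open>K\<close>, one for each \<open>a \<in> F\<close>. Two such graphs
meet only in \<open>0\<close> since \<open>F\<close> has no zero divisors. Together these subspaces contain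
\<open>q ^ m * (q ^ k - 1) + (q ^ m - 1) = q ^ (m + k) - 1\<close> nonzero vectors, that is, all of them, and this is
why the inequalities derived from them are sharp for stars.
\<close>

lemma exists_partial_spread:
  assumes n: "m + k = CARD('n)" and km: "k \<le> m" and k: "k > 0"
  obtains P and Y :: "('a :: {field, finite} ^ 'n) set" where
    "vec.subspace Y" "vec.dim Y = m" "card P = CARD('a) ^ m"
    "\<And>x. x \<in> P \<Longrightarrow> vec.subspace x \<and> vec.dim x = k \<and> x \<inter> Y = {0}"
    "\<And>x y. x \<in> P \<Longrightarrow> y \<in> P \<Longrightarrow> x \<noteq> y \<Longrightarrow> x \<inter> y = {0}"
proof -
  have "m > 0" using k km by simp
  then obtain B :: "'a alg_closure set" where B: "finite B" "card B = m"
    "\<forall>c. (\<Sum>b\<in>B. to_ac (c b) * b) = 0 \<longrightarrow> (\<forall>b\<in>B. c b = 0)"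
    "subfield_roots m = range (\<lambda>c. \<Sum>b\<in>B. to_ac (c b) * b)"
    by (rule subfield_roots_basis)
  let ?F = "subfield_roots m :: 'a alg_closure set"
  obtain I :: "'n set" where I: "card I = m"
    using obtain_subset_with_card_n[of m "UNIV :: 'n set"] n by auto
  have cI: "card (- I) = k"
    using n I by (simp add: Compl_eq_Diff_UNIV card_Diff_subset)
  obtain e where e: "bij_betw e I B"
    using finite_same_card_bij[of I B] B I by auto
  obtain e' where e': "e' ` (- I) \<subseteq> B" "inj_on e' (- I)"
    using card_le_inj[of "- I" B] B cI km by auto
  have indep: "c j = 0"
    if "inj_on h J" "h ` J \<subseteq> B" "(\<Sum>j\<in>J. to_ac (c j) * h j) = 0" "j \<in> J"
    for h and J :: "'n set" and c j
  proof -
    define d where "d b = (if b \<in> h ` J then c (inv_into J h b) else 0)" for b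
    have "(\<Sum>b\<in>B. to_ac (d b) * b) = (\<Sum>b\<in>h ` J. to_ac (d b) * b)"
      using that(2) B(1) by (intro sum.mono_neutral_right) (auto simp: d_def)
    also have "\<dots> = (\<Sum>j\<in>J. to_ac (c j) * h j)"
      using that(1) by (subst sum.reindex) (auto simp: d_def)
    finally have "d (h j) = 0"
      using B(3)[rule_format, of d "h j"] that by auto
    then show ?thesis using that by (simp add: d_def)
  qed
  (* The coordinates in I parametrise F, the remaining ones the subspace K spanned by the image of e'. *)
  define f where "f v = (\<Sum>i\<in>I. to_ac (v $ i) * e i)" for v :: "'a ^ 'n"
  define g where "g v = (\<Sum>i\<in>- I. to_ac (v $ i) * e' i)" for v :: "'a ^ 'n"
  have f_add: "f (v + w) = f v + f w" and g_add: "g (v + w) = g v + g w" for v w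
    by (simp_all add: f_def g_def algebra_simps sum.distrib)
  have f_diff: "f (v - w) = f v - f w" and g_diff: "g (v - w) = g v - g w" for v w
    by (simp_all add: f_def g_def algebra_simps sum_subtractf)
  have f_scale: "f (c *s v) = to_ac c * f v" and g_scale: "g (c *s v) = to_ac c * g v" for c v
    by (simp_all add: f_def g_def sum_distrib_left mult.assoc)
  have f_0: "f 0 = 0" and g_0: "g 0 = 0" by (simp_all add: f_def g_def)
  have f_eq_0: "v $ i = 0" if "f v = 0" "i \<in> I" for v :: "'a ^ 'n" and i
    using indep[of e I "($) v" i] e that by (auto simp: f_def bij_betw_def)
  have g_eq_0: "v $ i = 0" if "g v = 0" "i \<notin> I" for v :: "'a ^ 'n" and i
    using indep[of e' "- I" "($) v" i] e' that by (auto simp: g_def)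
  have eq_0: "v = 0" if "f v = 0" "g v = 0" for v
    using f_eq_0[OF that(1)] g_eq_0[OF that(2)] by (auto simp: vec_eq_iff)
  define Y where "Y = {v. g v = 0}"
  define x where "x a = {v. f v = a * g v}" for a
  have Y_sub: "vec.subspace Y"
    by (auto simp: vec.subspace_def Y_def g_0 g_add g_scale)
  have x_sub: "vec.subspace (x a)" for a
    by (auto simp: vec.subspace_def x_def f_0 g_0 f_add g_add f_scale g_scale algebra_simps)
  have "Y = {v. \<forall>i. i \<notin> I \<longrightarrow> v $ i = 0}"
    using g_eq_0 by (auto simp: Y_def) (simp add: g_def)
  then have Y_dim: "vec.dim Y = m"
    using dim_substandard_cart[of I] by (simp add: I)
  have xY: "x a \<inter> Y = {0}" for a
    using eq_0 by (auto simp: x_def Y_def f_0 g_0)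
  have xx: "x a \<inter> x b = {0}" if "a \<noteq> b" for a b
  proof -
    have "v = 0" if "f v = a * g v" "f v = b * g v" for v
    proof -
      have "a * g v = b * g v" using that by metis
      then have "g v = 0" using \<open>a \<noteq> b\<close> by simp
      then show ?thesis using that eq_0[of v] by simp
    qed
    then show ?thesis by (auto simp: x_def f_0 g_0)
  qed
  have x_dim: "vec.dim (x a) = k" if a: "a \<in> ?F" for a
  proof (rule dim_eqI_card[OF x_sub])
    let ?r = "\<lambda>v :: 'a ^ 'n. restrict (($) v) (- I)"
    have "inj_on ?r (x a)"
    proof (rule inj_onI)
      fix v w assume v: "v \<in> x a" and w: "w \<in> x a" and eq: "?r v = ?r w"
      have "v $ i = w $ i" if "i \<notin> I" for i
        using fun_cong[OF eq, of i] that by simp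
      then have "g v = g w" by (simp add: g_def)
      then have "f v = f w" using v w by (simp add: x_def)
      with \<open>g v = g w\<close> have "v - w = 0" by (intro eq_0) (simp_all add: f_diff g_diff)
      then show "v = w" by simp
    qed
    moreover have "?r ` x a = (- I \<rightarrow>\<^sub>E UNIV)"
    proof (intro equalityI subsetI)
      fix u :: "'n \<Rightarrow> 'a" assume u: "u \<in> - I \<rightarrow>\<^sub>E UNIV"
      define d where "d b = (if b \<in> e' ` (- I) then u (inv_into (- I) e' b) else 0)" for b
      have "(\<Sum>b\<in>B. to_ac (d b) * b) = (\<Sum>b\<in>e' ` (- I). to_ac (d b) * b)"
        using e'(1) B(1) by (intro sum.mono_neutral_right) (auto simp: d_def)
      also have "\<dots> = (\<Sum>i\<in>- I. to_ac (u i) * e' i)"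
        using e'(2) by (subst sum.reindex) (auto simp: d_def)
      finally have "(\<Sum>i\<in>- I. to_ac (u i) * e' i) \<in> ?F"
        unfolding B(4) by (intro range_eqI [where x = d]) (rule sym)
      then have "a * (\<Sum>i\<in>- I. to_ac (u i) * e' i) \<in> ?F"
        using a by (rule subfield_roots_mult[rotated])
      then obtain c where c: "a * (\<Sum>i\<in>- I. to_ac (u i) * e' i) = (\<Sum>b\<in>B. to_ac (c b) * b)"
        unfolding B(4) by (rule rangeE)
      define v :: "'a ^ 'n" where "v = (\<chi> i. if i \<in> I then c (e i) else u i)"
      have "f v = (\<Sum>i\<in>I. to_ac (c (e i)) * e i)" by (simp add: f_def v_def)
      also have "\<dots> = (\<Sum>b\<in>B. to_ac (c b) * b)"
        by (rule sum.reindex_bij_betw[OF e])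
      also have "\<dots> = a * g v" unfolding c[symmetric] by (simp add: g_def v_def)
      finally have "v \<in> x a" by (simp add: x_def)
      moreover have "u = ?r v" using u by (auto simp: v_def fun_eq_iff restrict_def PiE_def extensional_def)
      ultimately show "u \<in> ?r ` x a" by blast
    qed auto
    ultimately have "card (x a) = card (- I \<rightarrow>\<^sub>E (UNIV :: 'a set))"
      by (metis card_image)
    then show "card (x a) = CARD('a) ^ k" by (simp add: card_PiE cI)
  qed
  have "inj_on x ?F"
  proof (rule inj_onI, rule ccontr)
    fix a b assume a: "a \<in> ?F" and "x a = x b" "a \<noteq> b"
    then have "x a = {0}" using xx[of a b] by auto
    then show False using x_dim[OF a] k vec.dim_eq_0[of "x a"] by auto
  qed
  then have "card (x ` ?F) = CARD('a) ^ m"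
    by (simp add: card_image card_subfield_roots \<open>m > 0\<close>)
  with Y_sub Y_dim show thesis
  proof (rule that)
    show "vec.subspace z \<and> vec.dim z = k \<and> z \<inter> Y = {0}" if "z \<in> x ` ?F" for z
      using that x_sub x_dim xY by auto
    show "z \<inter> z' = {0}" if "z \<in> x ` ?F" "z' \<in> x ` ?F" "z \<noteq> z'" for z z'
      using that by (elim imageE) (metis xx)
  qed
qed

section \<open>Averaging over the general linear group\<close>

definition GL :: "('a :: {field, finite} ^ 'n \<Rightarrow> 'a ^ 'n) set" where
  "GL = {g. Vector_Spaces.linear (*s) (*s) g \<and> inj g}"

definition level :: "nat \<Rightarrow> ('a :: {field, finite} ^ 'n) set set" where
  "level k = {x \<in> Omega. vec.dim x = k}"

lemma finite_GL: "finite (GL :: ('a :: {field, finite} ^ 'n \<Rightarrow> _) set)"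
  by (rule finite_subset[OF subset_UNIV]) simp

lemma id_in_GL: "id \<in> GL"
  using vec.linear_id by (auto simp: GL_def id_def)

lemma card_GL_pos: "card (GL :: ('a :: {field, finite} ^ 'n \<Rightarrow> _) set) > 0"
  using id_in_GL finite_GL card_gt_0_iff by blast

lemma GL_compose: "g \<in> GL \<Longrightarrow> h \<in> GL \<Longrightarrow> g \<circ> h \<in> GL"
  by (auto simp: GL_def inj_compose Vector_Spaces.linear_compose)

lemma GL_image_level:
  assumes "g \<in> GL" "x \<in> level k"
  shows "g ` x \<in> level k"
proof -
  have g: "Vector_Spaces.linear (*s) (*s) g" "inj g" using assms(1) by (auto simp: GL_def)
  then interpret g: Vector_Spaces.linear "(*s)" "(*s)" g by blast
  have x: "vec.subspace x" "vec.dim x = k"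
    using assms(2) by (auto simp: level_def Omega_def)
  have "vec.dim (g ` x) = vec.dim x"
    using g by (intro vec.dim_image_eq) (auto intro: inj_on_subset)
  then show ?thesis
    using x g.subspace_image by (auto simp: level_def Omega_def)
qed

lemma GL_transitive:
  assumes x: "x \<in> level k" and y: "y \<in> level k"
  obtains g where "g \<in> GL" "g ` x = y"
proof -
  obtain B where B: "B \<subseteq> x" "vec.independent B" "x \<subseteq> vec.span B" "card B = vec.dim x"
    by (rule vec.basis_exists)
  obtain C where C: "C \<subseteq> y" "vec.independent C" "y \<subseteq> vec.span C" "card C = vec.dim y"
    by (rule vec.basis_exists)
  have span: "vec.span B = x" "vec.span C = y"
    using B C x y by (simp_all add: vec.span_subspace level_def Omega_def)
  have "card B = card C" using B C x y by (simp add: level_def)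
  then obtain h where h: "bij_betw h B C"
    using finite_same_card_bij vec.finiteI_independent B(2) C(2) by blast
  then obtain g where g: "Vector_Spaces.linear (*s) (*s) g" "inj g" "\<forall>b\<in>B. g b = h b"
    using vec.linear_independent_extend_inj[of B h] B(2) C(2) by (auto simp: bij_betw_def)
  then interpret g: Vector_Spaces.linear "(*s)" "(*s)" g by blast
  have "g ` B = C" using g(3) h by (auto simp: bij_betw_def image_def)
  then have "g ` x = y" using g.span_image[of B] span by simp
  moreover have "g \<in> GL" using g by (simp add: GL_def)
  ultimately show thesis using that by blast
qed

text \<open>
By transitivity, \<open>g ` x\<close> is uniformly distributed over the subspaces of the dimension of \<open>x\<close> when
\<open>g\<close> runs through the general linear group.
\<close>

lemma card_GL_image_in:
  fixes x :: "('a :: {field, finite} ^ 'n) set"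
  assumes x: "x \<in> level k" and U: "U \<subseteq> level k"
  shows "card {g \<in> GL. g ` x \<in> U} * card (level k :: ('a ^ 'n) set set) =
    card U * card (GL :: ('a ^ 'n \<Rightarrow> _) set)"
proof -
  define c where "c = card {g \<in> GL. g ` x = x}"
  have le: "card {g \<in> GL. g ` x = z} \<le> card {g \<in> GL. g ` x = f ` z}"
    if f: "f \<in> GL" for f and z :: "('a ^ 'n) set"
  proof (rule card_inj_on_le)
    show "inj_on (\<lambda>g. f \<circ> g) {g \<in> GL. g ` x = z}"
    proof (intro inj_onI ext)
      fix g h v assume "f \<circ> g = f \<circ> h"
      then have "f (g v) = f (h v)" by (metis comp_apply)
      then show "g v = h v" using f by (simp add: GL_def inj_eq)
    qed
    show "(\<lambda>g. f \<circ> g) ` {g \<in> GL. g ` x = z} \<subseteq> {g \<in> GL. g ` x = f ` z}"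
    proof
      fix k assume "k \<in> (\<lambda>g. f \<circ> g) ` {g \<in> GL. g ` x = z}"
      then obtain g where g: "g \<in> GL" "g ` x = z" "k = f \<circ> g" by blast
      have "k ` x = f ` z" unfolding g(3) g(2)[symmetric] by (rule image_comp[symmetric])
      then show "k \<in> {g \<in> GL. g ` x = f ` z}"
        using GL_compose[OF f g(1)] g(3) by blast
    qed
  qed (use finite_GL in auto)
  have c: "card {g \<in> GL. g ` x = y} = c" if y: "y \<in> level k" for y
  proof -
    obtain h where h: "h \<in> GL" "h ` x = y" by (rule GL_transitive[OF x y])
    obtain h' where h': "h' \<in> GL" "h' ` y = x" by (rule GL_transitive[OF y x])
    have "card {g \<in> GL. g ` x = x} \<le> card {g \<in> GL. g ` x = y}"
      using le[OF h(1), of x] h(2) by simp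
    moreover have "card {g \<in> GL. g ` x = y} \<le> card {g \<in> GL. g ` x = x}"
      using le[OF h'(1), of y] h'(2) by simp
    ultimately show ?thesis by (simp add: c_def)
  qed
  have sum: "card {g \<in> GL. g ` x \<in> W} = card W * c" if W: "W \<subseteq> level k" for W
  proof -
    have "{g \<in> GL. g ` x \<in> W} = (\<Union>y\<in>W. {g \<in> GL. g ` x = y})" by auto
    also have "card \<dots> = (\<Sum>y\<in>W. card {g \<in> GL. g ` x = y})"
      using finite_GL by (intro card_UN_disjoint) (auto intro: finite_subset[OF subset_UNIV])
    also have "\<dots> = card W * c" using c W by (simp add: subset_iff)
    finally show ?thesis .
  qed
  have "{g \<in> GL. g ` x \<in> level k} = GL" using GL_image_level x by blast
  with sum[of "level k"] have "card (GL :: ('a ^ 'n \<Rightarrow> _) set) = card (level k :: ('a ^ 'n) set set) * c"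
    by simp
  then show ?thesis using sum[OF U] by simp
qed

text \<open>
The value at \<open>k\<close> is meaningful only for \<open>k\<close> up to the dimension of the space; above it the level is
empty and the quotient is \<open>0\<close>.
\<close>

definition level_density :: "('a :: {field, finite} ^ 'n) set set \<Rightarrow> nat \<Rightarrow> real" where
  "level_density U k = card (U \<inter> level k) / card (level k :: ('a ^ 'n) set set)"

text \<open>
For every \<open>g\<close> the images \<open>g ` x\<close> with \<open>x \<in> P\<close> still meet pairwise in \<open>0\<close>, so an intersecting family
contains at most one of them. The left-hand side is the average over \<open>g\<close> of the number of these
images that lie in \<open>U\<close>.
\<close>

lemma sum_density_le_1:
  fixes U P :: "('a :: {field, finite} ^ 'n) set set"
  assumes U: "intersecting U" and P: "P \<subseteq> Omega"
    and disj: "\<And>x y. x \<in> P \<Longrightarrow> y \<in> P \<Longrightarrow> x \<noteq> y \<Longrightarrow> x \<inter> y = {0}"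
  shows "(\<Sum>x\<in>P. level_density U (vec.dim x)) \<le> 1"
proof -
  let ?G = "GL :: ('a ^ 'n \<Rightarrow> 'a ^ 'n) set"
  have finP: "finite P" by (rule finite_subset[OF subset_UNIV]) simp
  have one: "card {x \<in> P. g ` x \<in> U} \<le> 1" if g: "g \<in> ?G" for g
  proof -
    have "x = y" if x: "x \<in> P" "g ` x \<in> U" and y: "y \<in> P" "g ` y \<in> U" for x y
    proof (rule ccontr)
      assume "x \<noteq> y"
      then have "g ` x \<inter> g ` y = g ` {0}"
        using disj x y g by (auto simp: GL_def image_Int [symmetric])
      also have "\<dots> = {0}"
        using g vec.linear_0 by (auto simp: GL_def)
      finally show False using U x y by (auto simp: intersecting_def)
    qed
    then show ?thesis using finP by (auto simp: card_le_Suc0_iff_eq)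
  qed
  have dens: "level_density U (vec.dim x) = card {g \<in> ?G. g ` x \<in> U} / card ?G" if "x \<in> P" for x
  proof -
    define k where "k = vec.dim x"
    have x: "x \<in> level k" using that P by (auto simp: level_def k_def)
    have "{g \<in> ?G. g ` x \<in> U} = {g \<in> ?G. g ` x \<in> U \<inter> level k}"
      using GL_image_level[OF _ x] by auto
    with card_GL_image_in[OF x, of "U \<inter> level k"]
    have "card {g \<in> ?G. g ` x \<in> U} * card (level k :: ('a ^ 'n) set set) = card (U \<inter> level k) * card ?G"
      by simp
    then have "real (card {g \<in> ?G. g ` x \<in> U}) * card (level k :: ('a ^ 'n) set set)
      = card (U \<inter> level k) * card ?G"
      unfolding of_nat_mult [symmetric] by simp
    moreover have "card (level k :: ('a ^ 'n) set set) > 0"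
      using x by (auto simp: card_gt_0_iff)
    ultimately show ?thesis
      using card_GL_pos[where 'a = 'a and 'n = 'n] unfolding level_density_def k_def [symmetric]
      by (subst frac_eq_eq) (simp_all add: card_gt_0_iff)
  qed
  have "(\<Sum>x\<in>P. card {g \<in> ?G. g ` x \<in> U}) = (\<Sum>g\<in>?G. card {x \<in> P. g ` x \<in> U})"
    using sum.swap_restrict[OF finP finite_GL, of "\<lambda>_ _. 1 :: nat" "\<lambda>x g. g ` x \<in> U"] by simp
  also have "\<dots> \<le> card ?G" using sum_mono[OF one, of ?G] by simp
  finally have "(\<Sum>x\<in>P. real (card {g \<in> ?G. g ` x \<in> U})) \<le> card ?G"
    by (simp only: of_nat_le_iff flip: of_nat_sum)
  then show ?thesis
    using card_GL_pos[where 'a = 'a and 'n = 'n]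
    by (simp add: dens sum_divide_distrib [symmetric])
qed

lemma span_eq_line:
  assumes "x \<in> level 1" "v \<in> x" "v \<noteq> 0"
  shows "vec.span {v} = x"
  using assms vec.span_minimal [of "{v}" x]
  by (intro vec.subspace_dim_equal) (auto simp: level_def Omega_def)

lemma lines_Int_trivial:
  assumes x: "x \<in> level 1" and y: "y \<in> level 1" and "x \<noteq> y"
  shows "x \<inter> y = {0}"
proof (rule ccontr)
  assume "x \<inter> y \<noteq> {0}"
  moreover have "0 \<in> x \<inter> y" using x y vec.subspace_0 by (auto simp: level_def Omega_def)
  ultimately obtain v where v: "v \<in> x" "v \<in> y" "v \<noteq> 0" by blast
  then show False
    using span_eq_line [OF x v(1,3)] span_eq_line [OF y v(2,3)] \<open>x \<noteq> y\<close> by simp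
qed

lemma card_lines:
  fixes Y :: "('a :: {field, finite} ^ 'n) set"
  assumes Y: "vec.subspace Y"
  shows "card {x \<in> level 1. x \<subseteq> Y} * (CARD('a) - 1) = CARD('a) ^ vec.dim Y - 1"
proof -
  let ?L = "{x \<in> level 1. x \<subseteq> Y}"
  have "Y - {0} = (\<Union>x\<in>?L. x - {0})"
  proof (intro equalityI subsetI)
    fix v assume v: "v \<in> Y - {0}"
    then have "vec.span {v} \<in> ?L"
      using vec.span_minimal[of "{v}" Y] Y by (auto simp: level_def Omega_def)
    moreover have "v \<in> vec.span {v}" by (simp add: vec.span_base)
    ultimately show "v \<in> (\<Union>x\<in>?L. x - {0})" using v by blast
  qed auto
  also have "card \<dots> = (\<Sum>x\<in>?L. card (x - {0}))"
  proof (rule card_UN_disjoint)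
    show "\<forall>x\<in>?L. \<forall>y\<in>?L. x \<noteq> y \<longrightarrow> (x - {0}) \<inter> (y - {0}) = {}"
      using lines_Int_trivial by blast
  qed (auto intro: finite_subset[OF subset_UNIV])
  also have "\<dots> = card ?L * (CARD('a) - 1)"
    by (simp add: level_def Omega_def card_subspace card_Diff_singleton vec.subspace_0)
  finally show ?thesis
    using Y by (simp add: card_subspace card_Diff_singleton vec.subspace_0)
qed

section \<open>Gaussian binomial coefficients and the masses of the levels\<close>

text \<open>
The Gaussian binomial coefficient, by its \<open>q\<close>-Pascal recursion, from which both the \<open>q\<close>-binomial
theorem and the product formula follow by induction.
\<close>

fun gbin :: "real \<Rightarrow> nat \<Rightarrow> nat \<Rightarrow> real" where
  "gbin q n 0 = 1"
| "gbin q 0 (Suc k) = 0"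
| "gbin q (Suc n) (Suc k) = gbin q n k + q ^ Suc k * gbin q n (Suc k)"

lemma gbin_eq_0: "n < k \<Longrightarrow> gbin q n k = 0"
proof (induction n arbitrary: k)
  case 0
  then show ?case by (cases k) auto
next
  case (Suc n)
  then show ?case by (cases k) auto
qed

lemma gbin_Suc_mult: "k \<le> n \<Longrightarrow> gbin q n (Suc k) * (q ^ Suc k - 1) = gbin q n k * (q ^ (n - k) - 1)"
proof (induction n arbitrary: k)
  case (Suc n)
  have upper: "gbin q (Suc n) k * (q ^ (Suc n - k) - 1) = gbin q n k * (q ^ Suc n - 1)" if "k \<le> n"
  proof (cases k)
    case (Suc j)
    then obtain i where i: "n = Suc (j + i)"
      using \<open>k \<le> n\<close> less_iff_Suc_add [of j n] by auto
    have "gbin q n (Suc j) * (q ^ Suc j - 1) = gbin q n j * (q ^ (n - j) - 1)"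
      using Suc that by (intro Suc.IH) simp
    moreover have "q ^ Suc n = q ^ Suc j * q ^ Suc i" "q ^ (n - j) = q ^ Suc i"
      by (simp_all add: i power_add)
    moreover have "Suc n - k = Suc i" by (simp add: Suc i)
    moreover have "(a + Q * b) * (R - 1) = b * (Q * R - 1)"
      if "b * (Q - 1) = a * (R - 1)" for a b Q R :: real
    proof -
      have "(a + Q * b) * (R - 1) = a * (R - 1) + Q * b * (R - 1)" by (rule distrib_right)
      also have "\<dots> = b * (Q - 1) + Q * b * (R - 1)" by (simp only: that)
      also have "\<dots> = b * (Q * R - 1)" by (simp add: algebra_simps)
      finally show ?thesis .
    qed
    ultimately show ?thesis
      by (simp only: Suc gbin.simps)
  qed simp
  show ?case
  proof (cases "k \<le> n")
    case True
    then obtain i where i: "n = k + i" using le_Suc_ex by blast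
    have "gbin q n (Suc k) * (q ^ Suc k - 1) = gbin q n k * (q ^ (n - k) - 1)"
      using True by (rule Suc.IH)
    moreover have "q ^ Suc n = q ^ Suc k * q ^ (n - k)"
      by (simp add: i power_add)
    moreover have "(a + Q * b) * (Q - 1) = a * (Q * R - 1)"
      if "b * (Q - 1) = a * (R - 1)" for a b Q R :: real
    proof -
      have "(a + Q * b) * (Q - 1) = a * (Q - 1) + Q * (b * (Q - 1))" by (simp add: algebra_simps)
      also have "\<dots> = a * (Q - 1) + Q * (a * (R - 1))" by (simp only: that)
      also have "\<dots> = a * (Q * R - 1)" by (simp add: algebra_simps)
      finally show ?thesis .
    qed
    ultimately have "gbin q (Suc n) (Suc k) * (q ^ Suc k - 1) = gbin q n k * (q ^ Suc n - 1)"
      by (simp only: gbin.simps)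
    then show ?thesis by (simp only: upper [OF True])
  next
    case False
    then have k: "k = Suc n" using Suc.prems by simp
    show ?thesis by (simp add: k gbin_eq_0)
  qed
qed simp

lemma gbin_mult_prod:
  "k \<le> n \<Longrightarrow> gbin q n k * (\<Prod>i<k. q ^ k - q ^ i) = (\<Prod>i<k. q ^ n - q ^ i)"
proof (induction k)
  case (Suc k)
  let ?p = "\<Prod>i<k. q ^ k - q ^ i"
  have "(\<Prod>i<Suc k. q ^ Suc k - q ^ i) = (q ^ Suc k - 1) * (\<Prod>i<k. q * (q ^ k - q ^ i))"
    by (subst prod.lessThan_Suc_shift) (simp add: algebra_simps)
  also have "\<dots> = (q ^ Suc k - 1) * (q ^ k * ?p)"
    by (simp only: prod.distrib prod_constant card_lessThan)
  finally have "gbin q n (Suc k) * (\<Prod>i<Suc k. q ^ Suc k - q ^ i)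
      = (gbin q n (Suc k) * (q ^ Suc k - 1)) * q ^ k * ?p"
    by (simp only: mult_ac)
  also have "\<dots> = (gbin q n k * (q ^ (n - k) - 1)) * q ^ k * ?p"
    using Suc.prems by (subst gbin_Suc_mult) simp_all
  also have "\<dots> = (q ^ k * (q ^ (n - k) - 1)) * (gbin q n k * ?p)"
    by (simp only: mult_ac)
  also have "q ^ k * (q ^ (n - k) - 1) = q ^ n - q ^ k"
    using Suc.prems by (simp add: right_diff_distrib flip: power_add)
  also have "gbin q n k * ?p = (\<Prod>i<k. q ^ n - q ^ i)"
    using Suc by simp
  finally show ?case by (simp only: prod.lessThan_Suc mult.commute)
qed simp

lemma gbin_pos:
  assumes "q > 1" "k \<le> n"
  shows "gbin q n k > 0"
proof (rule zero_less_mult_pos2)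
  have "(\<Prod>i<k. q ^ n - q ^ i) > 0" using assms by (intro prod_pos) simp
  then show "gbin q n k * (\<Prod>i<k. q ^ k - q ^ i) > 0" by (simp only: gbin_mult_prod [OF assms(2)])
  show "(\<Prod>i<k. q ^ k - q ^ i) > 0" using assms by (intro prod_pos) simp
qed

lemma gbin_self: "gbin q n n = 1"
  by (induction n) (simp_all add: gbin_eq_0)

lemma gbin_nonneg: "q \<ge> 0 \<Longrightarrow> gbin q n k \<ge> 0"
  by (induction q n k rule: gbin.induct) auto

lemma gbin_symmetric:
  assumes q: "q > 1"
  shows "k \<le> n \<Longrightarrow> gbin q n (n - k) = gbin q n k"
proof (induction k)
  case (Suc k)
  define j where "j = n - Suc k"
  have j: "n - k = Suc j" "n - j = Suc k" "j \<le> n" using Suc.prems by (auto simp: j_def)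
  have "gbin q n j * (q ^ Suc k - 1) = gbin q n (Suc j) * (q ^ Suc j - 1)"
    using gbin_Suc_mult [OF j(3), of q] j(2) by simp
  also have "\<dots> = gbin q n (Suc k) * (q ^ Suc k - 1)"
    using Suc gbin_Suc_mult [of k n q] j(1) by simp
  finally show ?case using q one_less_power [of q "Suc k"] by (simp add: j_def)
qed (simp add: gbin_self)

lemma Suc_choose_two: "Suc k choose 2 = k + (k choose 2)"
  by (simp add: numeral_2_eq_2)

lemma add_choose_two: "(k + d) choose 2 = (k choose 2) + (d choose 2) + d * k"
  by (induction d) (simp_all add: Suc_choose_two)

lemma q_binomial:
  "(\<Sum>k\<le>n. gbin q n k * (s ^ k * q ^ (k choose 2))) = (\<Prod>j<n. 1 + s * q ^ j)"
proof (induction n arbitrary: s)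
  case (Suc n)
  let ?t = "\<lambda>n s k. gbin q n k * (s ^ k * q ^ (k choose 2))"
  have step: "?t (Suc n) s (Suc k) = s * ?t n (s * q) k + ?t n (s * q) (Suc k)" for k
    by (simp add: Suc_choose_two power_add power_mult_distrib algebra_simps)
  have "(\<Sum>k\<le>Suc n. ?t (Suc n) s k) = 1 + (\<Sum>k\<le>n. ?t (Suc n) s (Suc k))"
    by (subst sum.atMost_Suc_shift) (simp add: binomial_eq_0)
  also have "\<dots> = s * (\<Sum>k\<le>n. ?t n (s * q) k) + (1 + (\<Sum>k\<le>n. ?t n (s * q) (Suc k)))"
    by (simp only: step sum.distrib sum_distrib_left)
  also have "1 + (\<Sum>k\<le>n. ?t n (s * q) (Suc k)) = (\<Sum>k\<le>Suc n. ?t n (s * q) k)"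
    by (subst sum.atMost_Suc_shift) (simp add: binomial_eq_0)
  also have "\<dots> = (\<Sum>k\<le>n. ?t n (s * q) k)"
    by (simp add: gbin_eq_0)
  also have "s * (\<Sum>k\<le>n. ?t n (s * q) k) + (\<Sum>k\<le>n. ?t n (s * q) k) = (1 + s) * (\<Prod>j<n. 1 + (s * q) * q ^ j)"
    by (simp only: Suc.IH distrib_right mult_1_left add.commute)
  also have "\<dots> = (\<Prod>j<Suc n. 1 + s * q ^ j)"
    by (subst prod.lessThan_Suc_shift) (simp add: mult_ac)
  finally show ?case .
qed (simp add: binomial_eq_0)

text \<open>
The unnormalised measure of the set of all \<open>k\<close>-dimensional subspaces of a space of dimension \<open>n\<close>.
\<close>

definition level_mass :: "real \<Rightarrow> real \<Rightarrow> nat \<Rightarrow> nat \<Rightarrow> real" where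
  "level_mass q s n k = gbin q n k * (s ^ k * q ^ (k choose 2))"

lemma level_mass_nonneg: "q \<ge> 0 \<Longrightarrow> s \<ge> 0 \<Longrightarrow> level_mass q s n k \<ge> 0"
  by (simp add: level_mass_def gbin_nonneg)

lemma level_mass_Suc:
  assumes "k \<le> n"
  shows "level_mass q s n (Suc k) * (q ^ Suc k - 1) = level_mass q s n k * (s * (q ^ n - q ^ k))"
proof -
  have "level_mass q s n (Suc k) * (q ^ Suc k - 1)
      = (gbin q n (Suc k) * (q ^ Suc k - 1)) * (s ^ Suc k * q ^ (Suc k choose 2))"
    by (simp only: level_mass_def mult_ac)
  also have "\<dots> = (gbin q n k * (q ^ (n - k) - 1)) * (s ^ Suc k * q ^ (Suc k choose 2))"
    by (simp only: gbin_Suc_mult [OF assms])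
  also have "\<dots> = level_mass q s n k * (s * (q ^ k * (q ^ (n - k) - 1)))"
    by (simp add: level_mass_def Suc_choose_two power_add)
  also have "q ^ k * (q ^ (n - k) - 1) = q ^ n - q ^ k"
    using assms by (simp add: right_diff_distrib flip: power_add)
  finally show ?thesis .
qed

lemma level_mass_complement:
  assumes q: "q > 1" and n: "n = 2 * k + d"
  shows "level_mass q s n (n - k) = level_mass q s n k * (s ^ d * q ^ ((d choose 2) + d * k))"
proof -
  have "n - k = k + d" using n by simp
  then have "level_mass q s n (n - k) = gbin q n (n - k) * (s ^ (k + d) * q ^ ((k + d) choose 2))"
    by (simp only: level_mass_def)
  then show ?thesis
    using gbin_symmetric [OF q, of k n] n by (simp add: level_mass_def add_choose_two power_add)
qed

text \<open>
The number \<open>(q ^ k - 1) / (q ^ n - 1)\<close> is the proportion of \<open>k\<close>-dimensional subspaces that contain a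
given line, so the sum is the unnormalised measure of a star. The recursion for consecutive level
masses turns \<open>\<Sum>k. T k * (q ^ k - 1)\<close> into \<open>s * (\<Sum>k. T k * (q ^ n - q ^ k))\<close>. This is a linear equation
for \<open>\<Sum>k. T k * q ^ k\<close> in terms of the total mass, which the \<open>q\<close>-binomial theorem supplies.
\<close>

lemma sum_level_mass_star:
  assumes q: "q > 1" and s: "s > 0" and n: "n > 0"
  shows "(\<Sum>k=1..n. level_mass q s n k * ((q ^ k - 1) / (q ^ n - 1))) =
    s / (1 + s) * (\<Prod>j<n. 1 + s * q ^ j)"
proof -
  let ?T = "level_mass q s n"
  let ?Z = "\<Sum>k\<le>n. ?T k" and ?W = "\<Sum>k\<le>n. ?T k * q ^ k"
  have "?W - ?Z = (\<Sum>k\<le>n. ?T k * (q ^ k - 1))"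
    by (simp add: algebra_simps sum_subtractf)
  also have "\<dots> = (\<Sum>k<n. ?T (Suc k) * (q ^ Suc k - 1))"
    by (subst sum.atMost_shift) simp
  also have "\<dots> = (\<Sum>k<n. ?T k * (s * (q ^ n - q ^ k)))"
    by (intro sum.cong refl level_mass_Suc) simp
  also have "\<dots> = (\<Sum>k\<le>n. ?T k * (s * (q ^ n - q ^ k)))"
    by (simp add: lessThan_Suc_atMost [symmetric])
  also have "\<dots> = s * (q ^ n * ?Z - ?W)"
    by (simp add: algebra_simps sum_subtractf sum_distrib_left)
  finally have W: "(?W - ?Z) * (1 + s) = s * (q ^ n - 1) * ?Z" by (simp add: algebra_simps)
  have qn: "q ^ n > 1" using q n by (simp add: one_less_power)
  have "(\<Sum>k=1..n. ?T k * ((q ^ k - 1) / (q ^ n - 1))) = (\<Sum>k\<le>n. ?T k * (q ^ k - 1)) / (q ^ n - 1)"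
    unfolding atMost_atLeast0 by (subst (2) sum.atLeast_Suc_atMost) (simp_all add: sum_divide_distrib)
  also have "\<dots> = (?W - ?Z) / (q ^ n - 1)"
    by (simp add: algebra_simps sum_subtractf)
  also have "\<dots> = s / (1 + s) * ?Z"
    using W qn s by (simp add: field_simps)
  also have "?Z = (\<Prod>j<n. 1 + s * q ^ j)"
    unfolding level_mass_def by (rule q_binomial)
  finally show ?thesis .
qed

section \<open>The number of subspaces of each dimension\<close>

definition frames :: "('a :: {field, finite} ^ 'n) set \<Rightarrow> nat \<Rightarrow> ('a ^ 'n) list set" where
  "frames S k = {vs. length vs = k \<and> distinct vs \<and> vec.independent (set vs) \<and> set vs \<subseteq> S}"

lemma finite_frames: "finite (frames (S :: ('a :: {field, finite} ^ 'n) set) k)"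
  by (rule finite_subset[OF _ finite_lists_length_eq[of S k]]) (auto simp: frames_def)

lemma dim_span_frame:
  "vs \<in> frames S k \<Longrightarrow> vec.dim (vec.span (set vs)) = k"
  by (auto simp: frames_def vec.dim_span_eq_card_independent distinct_card simp del: vec.dim_span)

lemma card_frames:
  fixes S :: "('a :: {field, finite} ^ 'n) set"
  assumes S: "vec.subspace S"
  shows "card (frames S k) = (\<Prod>i<k. CARD('a) ^ vec.dim S - CARD('a) ^ i)"
proof (induction k)
  case 0
  have "frames S 0 = {[]}" by (auto simp: frames_def vec.independent_empty)
  then show ?case by simp
next
  case (Suc k)
  let ?E = "SIGMA vs : frames S k. S - vec.span (set vs)"
  have "frames S (Suc k) = (\<lambda>(vs, v). v # vs) ` ?E"
  proof (intro equalityI subsetI)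
    fix ws assume ws: "ws \<in> frames S (Suc k)"
    then obtain v vs where "ws = v # vs" by (cases ws) (auto simp: frames_def)
    with ws show "ws \<in> (\<lambda>(vs, v). v # vs) ` ?E"
      by (intro image_eqI[where x = "(vs, v)"]) (auto simp: frames_def vec.independent_insert)
  next
    fix ws assume "ws \<in> (\<lambda>(vs, v). v # vs) ` ?E"
    then obtain v vs where v: "ws = v # vs" "vs \<in> frames S k" "v \<in> S" "v \<notin> vec.span (set vs)"
      by auto
    then have "v \<notin> set vs" using vec.span_base by blast
    with v show "ws \<in> frames S (Suc k)"
      by (simp add: frames_def vec.independent_insert)
  qed
  then have "card (frames S (Suc k)) = card ?E"
    by (simp add: card_image inj_on_def)
  also have "\<dots> = (\<Sum>vs\<in>frames S k. card (S - vec.span (set vs)))"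
    by (intro card_SigmaI finite_frames) (auto intro: finite_subset[OF subset_UNIV])
  also have "\<dots> = (\<Sum>vs\<in>frames S k. CARD('a) ^ vec.dim S - CARD('a) ^ k)"
  proof (intro sum.cong refl)
    fix vs assume vs: "vs \<in> frames S k"
    then have "vec.span (set vs) \<subseteq> S"
      using S by (auto simp: frames_def intro: vec.span_minimal[THEN subsetD])
    then have "card (S - vec.span (set vs)) = card S - card (vec.span (set vs))"
      by (intro card_Diff_subset) (auto intro: finite_subset[OF subset_UNIV])
    then show "card (S - vec.span (set vs)) = CARD('a) ^ vec.dim S - CARD('a) ^ k"
      using dim_span_frame[OF vs] by (simp add: card_subspace S)
  qed
  finally show ?case by (simp add: Suc.IH)
qed

text \<open>
An ordered independent tuple of length \<open>k\<close> is an ordered basis of exactly one \<open>k\<close>-dimensional subspace.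
\<close>

lemma card_level_mult:
  "card (level k :: ('a :: {field, finite} ^ 'n) set set) * (\<Prod>i<k. CARD('a) ^ k - CARD('a) ^ i) =
    (\<Prod>i<k. CARD('a) ^ CARD('n) - CARD('a) ^ i)"
proof -
  let ?V = "UNIV :: ('a ^ 'n) set"
  have span: "vec.span (set vs) = x" if "x \<in> level k" "vs \<in> frames x k" for x :: "('a ^ 'n) set" and vs
  proof (rule vec.subspace_dim_equal)
    show "vec.dim x \<le> vec.dim (vec.span (set vs))"
      using that by (simp add: dim_span_frame level_def del: vec.dim_span)
  qed (use that in \<open>auto simp: level_def Omega_def frames_def intro: vec.span_minimal[THEN subsetD]\<close>)
  have "frames ?V k = (\<Union>x\<in>level k. frames x k)"
  proof (intro equalityI subsetI)
    fix vs assume vs: "vs \<in> frames ?V k"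
    then have "vec.span (set vs) \<in> level k"
      using dim_span_frame[OF vs] by (simp add: level_def Omega_def del: vec.dim_span)
    moreover have "vs \<in> frames (vec.span (set vs)) k"
      using vs vec.span_superset by (auto simp: frames_def)
    ultimately show "vs \<in> (\<Union>x\<in>level k. frames x k)" by blast
  qed (auto simp: frames_def)
  then have "card (frames ?V k) = card (\<Union>x\<in>(level k :: ('a ^ 'n) set set). frames x k)"
    by (rule arg_cong)
  also have "\<dots> = (\<Sum>x\<in>(level k :: ('a ^ 'n) set set). card (frames x k))"
  proof (intro card_UN_disjoint ballI impI finite_frames)
    fix x y :: "('a ^ 'n) set" assume xy: "x \<in> level k" "y \<in> level k" "x \<noteq> y"
    show "frames x k \<inter> frames y k = {}"
    proof (rule equals0I)
      fix vs assume "vs \<in> frames x k \<inter> frames y k"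
      then show False using span [OF xy(1)] span [OF xy(2)] xy(3) by blast
    qed
  qed (auto intro: finite_subset[OF subset_UNIV])
  also have "\<dots> = (\<Sum>x\<in>(level k :: ('a ^ 'n) set set). \<Prod>i<k. CARD('a) ^ k - CARD('a) ^ i)"
    by (intro sum.cong refl) (auto simp: level_def Omega_def card_frames)
  finally show ?thesis by (simp add: card_frames vec.subspace_UNIV card_cart_basis)
qed

lemma card_level:
  assumes k: "k \<le> CARD('n)"
  shows "real (card (level k :: ('a :: {field, finite} ^ 'n) set set)) = gbin CARD('a) CARD('n) k"
proof -
  define q where "q = CARD('a)"
  have q: "q > 1" unfolding q_def by (rule card_field_gt_1)
  have cast: "real (\<Prod>i<k. q ^ m - q ^ i) = (\<Prod>i<k. real q ^ m - real q ^ i)" if "k \<le> m" for m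
    unfolding of_nat_prod
  proof (intro prod.cong refl)
    fix i assume "i \<in> {..<k}"
    then have "q ^ i \<le> q ^ m" using q that by (intro power_increasing) auto
    then show "real (q ^ m - q ^ i) = real q ^ m - real q ^ i" by (simp add: of_nat_diff)
  qed
  have "real (card (level k :: ('a ^ 'n) set set)) * (\<Prod>i<k. real q ^ k - real q ^ i)
      = (\<Prod>i<k. real q ^ CARD('n) - real q ^ i)"
    using card_level_mult[of k, where 'a = 'a and 'n = 'n]
    unfolding q_def [symmetric] cast [OF k, symmetric] cast [OF order_refl, symmetric]
      of_nat_mult [symmetric] by simp
  also have "\<dots> = gbin q CARD('n) k * (\<Prod>i<k. real q ^ k - real q ^ i)"
    by (rule gbin_mult_prod [OF k, symmetric])
  finally have "real (card (level k :: ('a ^ 'n) set set)) * (\<Prod>i<k. real q ^ k - real q ^ i) =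
    gbin q CARD('n) k * (\<Prod>i<k. real q ^ k - real q ^ i)" .
  moreover have "(\<Prod>i<k. real q ^ k - real q ^ i) > 0"
    using q by (intro prod_pos) simp
  ultimately have "real (card (level k :: ('a ^ 'n) set set)) = gbin q CARD('n) k"
    by (metis less_irrefl mult_right_cancel)
  then show ?thesis by (simp add: q_def)
qed

section \<open>Weighted sums of deviations from the star\<close>

lemma sigma_bound_eq:
  assumes "p > 1" "n > 0"
  shows "sigma_bound p n = 1 / real p ^ (if odd n then n else n - 1)"
proof (cases "odd n")
  case False
  then obtain m where m: "n = Suc m" using assms(2) by (cases n) auto
  show ?thesis using False by (simp add: sigma_bound_cases m power_int_minus inverse_eq_divide del: power_Suc)
qed (simp add: sigma_bound_cases power_int_minus inverse_eq_divide)

lemma int_choose_two: "int (d choose 2) * 2 = int d * (int d - 1)"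
  by (induction d) (simp_all add: Suc_choose_two binomial_eq_0 algebra_simps)

text \<open>
The comparison of exponents of \<open>q\<close> behind \<open>q ^ (n - k) * T (n - k) \<le> T k\<close>, where \<open>n = 2 * k + d\<close>
and \<open>q ^ (- s)\<close> is the bound on \<open>\<sigma>\<close>. There is equality for \<open>d = 1\<close> and for \<open>d = 2\<close>, \<open>k = 1\<close>, so the
inequality of masses is sharp there when \<open>\<sigma>\<close> equals the bound.
\<close>

lemma exponent_gap:
  fixes k d :: nat
  assumes d: "d > 0" and k: "k > 0"
  defines "s \<equiv> if odd (2 * k + d) then 2 * k + d else 2 * k + d - 1"
  shows "(d choose 2) + d * k + (k + d) \<le> s * d"
    and "k = 1 \<Longrightarrow> d \<ge> 3 \<Longrightarrow> (d choose 2) + d * k + (k + d) + 5 \<le> s * d"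
proof -
  note ch = int_choose_two [of d]
  have odd_case: "int d = 2 * int e + 1 \<Longrightarrow> int (d choose 2) = (2 * int e + 1) * int e" for e
    using ch by (simp add: algebra_simps)
  have even_case: "int d = 2 * int e \<Longrightarrow> int (d choose 2) = int e * (2 * int e - 1)" for e
    using ch by (simp add: algebra_simps)
  have "int ((d choose 2) + d * k + (k + d)) \<le> int (s * d) \<and>
    (k = 1 \<and> d \<ge> 3 \<longrightarrow> int ((d choose 2) + d * k + (k + d) + 5) \<le> int (s * d))"
  proof (cases "odd d")
    case True
    then obtain e where e: "d = 2 * e + 1" by (elim oddE)
    have s: "int s = 2 * int k + 2 * int e + 1" using True by (simp add: s_def e)
    have gap: "int (s * d) - int ((d choose 2) + d * k + (k + d)) = 2 * int e * int k + (2 * int e * int e + int e)"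
      using odd_case [of e] by (simp add: s e algebra_simps)
    moreover have "int e * int e \<ge> 1" if "d \<ge> 3"
      using that e mult_mono [of 1 "int e" 1 "int e"] by auto
    ultimately show ?thesis using e by (auto simp: algebra_simps)
  next
    case False
    then have "even d" by simp
    then obtain e where e: "d = 2 * e" by (elim evenE)
    with d have e1: "int e \<ge> 1" by auto
    have e2: "int e \<ge> 2" if "d \<ge> 3" using that e by linarith
    have s: "int s = 2 * int k + 2 * int e - 1" using False k by (simp add: s_def e of_nat_diff)
    have gap: "int (s * d) - int ((d choose 2) + d * k + (k + d)) =
        int k * (2 * int e - 1) + int e * (2 * int e - 3)"
      using even_case [of e] by (simp add: s e algebra_simps)
    let ?G = "int k * (2 * int e - 1) + int e * (2 * int e - 3)"
    have "1 * (2 * int e - 1) \<le> int k * (2 * int e - 1)"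
      using k e1 by (intro mult_right_mono) auto
    moreover have "1 * (2 * int e - 1) \<le> int e * (2 * int e - 1)"
      using e1 by (intro mult_right_mono) auto
    moreover have "int e * (2 * int e - 1) = int e * (2 * int e - 3) + 2 * int e"
      by (simp add: algebra_simps)
    ultimately have "?G \<ge> 0" using e1 by (auto simp: algebra_simps)
    moreover have "?G \<ge> 5" if "k = 1" "d \<ge> 3"
    proof -
      have "2 * 1 \<le> int e * (2 * int e - 3)"
        using e2 [OF that(2)] by (intro mult_mono) auto
      then show ?thesis using e2 [OF that(2)] that(1) by simp
    qed
    ultimately show ?thesis using gap by linarith
  qed
  then show "(d choose 2) + d * k + (k + d) \<le> s * d"
    and "k = 1 \<Longrightarrow> d \<ge> 3 \<Longrightarrow> (d choose 2) + d * k + (k + d) + 5 \<le> s * d"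
    by (auto simp only: of_nat_le_iff)
qed

text \<open>
By \<open>level_mass_complement\<close> the number \<open>\<rho>\<close> is the quotient of \<open>q ^ (n - k) * T (n - k)\<close> by \<open>T k\<close>. The
constant \<open>1 / 32\<close> is \<open>2 ^ (- 5)\<close>, from the surplus of 5 in \<open>exponent_gap\<close>.
\<close>

lemma mass_ratio_bound:
  fixes p n :: nat and s :: real
  assumes p: "p > 1" and s: "s > 0" "s \<le> sigma_bound p n"
    and n: "n = 2 * k + d" and d: "d > 0" and k: "k > 0"
  defines "\<rho> \<equiv> s ^ d * real p ^ ((d choose 2) + d * k) * real p ^ (n - k)"
  shows "\<rho> \<le> 1" and "s < sigma_bound p n \<Longrightarrow> \<rho> < 1" and "k = 1 \<Longrightarrow> d \<ge> 3 \<Longrightarrow> \<rho> \<le> 1 / 32"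
proof -
  define t where "t = (if odd n then n else n - 1)"
  define m where "m = (d choose 2) + d * k + (k + d)"
  have bound: "sigma_bound p n = 1 / real p ^ t"
    using sigma_bound_eq [of p n] p n k by (simp add: t_def)
  have pt: "real p ^ t > 0" using p by simp
  have rho: "\<rho> = s ^ d * real p ^ m"
    using n by (simp add: \<rho>_def m_def power_add)
  have full: "s ^ d * real p ^ (t * d) = (s * real p ^ t) ^ d"
    by (simp add: power_mult power_mult_distrib)
  have le1: "s * real p ^ t \<le> 1" using s(2) pt by (simp add: bound field_simps)
  have exps: "m \<le> t * d" "k = 1 \<Longrightarrow> d \<ge> 3 \<Longrightarrow> m + 5 \<le> t * d"
    using exponent_gap [OF d k] unfolding m_def t_def n by blast+
  have "s ^ d * real p ^ m \<le> s ^ d * real p ^ (t * d)"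
    using exps(1) p s by (intro mult_left_mono power_increasing) auto
  then have le: "\<rho> \<le> (s * real p ^ t) ^ d" by (simp only: rho full)
  also have "\<dots> \<le> 1" using le1 s pt by (intro power_le_one) auto
  finally show "\<rho> \<le> 1" .
  show "\<rho> < 1" if "s < sigma_bound p n"
  proof -
    have "s * real p ^ t < 1" using that pt by (simp add: bound field_simps)
    then have "(s * real p ^ t) ^ d < 1" using d s pt by (simp add: power_less_one_iff)
    with le show ?thesis by simp
  qed
  show "\<rho> \<le> 1 / 32" if "k = 1" "d \<ge> 3"
  proof -
    have "\<rho> * 2 ^ 5 \<le> \<rho> * real p ^ 5"
      using p s by (intro mult_left_mono power_mono) (auto simp: rho)
    also have "\<dots> = s ^ d * real p ^ (m + 5)" by (simp add: rho power_add)
    also have "\<dots> \<le> s ^ d * real p ^ (t * d)"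
      using exps(2) [OF that] p s by (intro mult_left_mono power_increasing) auto
    also have "\<dots> \<le> 1" unfolding full using le1 s pt by (intro power_le_one) auto
    finally show ?thesis by simp
  qed
qed

text \<open>
Since \<open>\<sigma> * q ^ n \<le> q\<close>, the quotient of \<open>T (j + 1)\<close> by \<open>T j\<close> is at most \<open>q / (q ^ (j + 1) - 1)\<close>. As
\<open>q \<ge> 2\<close>, this is at most \<open>2 / 3\<close> for \<open>j = 1\<close> and at most \<open>2 / 7\<close> for \<open>j \<ge> 2\<close>.
\<close>

lemma mass_decay:
  fixes p n :: nat and s :: real
  assumes p: "p > 1" and s: "s > 0" "s \<le> sigma_bound p n" and n: "n \<ge> 2"
  shows "k + 2 \<le> n \<Longrightarrow> level_mass p s n (k + 2) \<le> level_mass p s n 1 * (2 / 3 * (2 / 7) ^ k)"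
proof -
  have p2: "real p \<ge> 2" using p by simp
  have sn: "s * real p ^ n \<le> real p"
  proof -
    define t where "t = (if odd n then n else n - 1)"
    have "s * real p ^ t \<le> 1"
      using s p n sigma_bound_eq [of p n] by (simp add: t_def field_simps)
    then have "s * real p ^ t * real p \<le> 1 * real p" using p by (intro mult_right_mono) auto
    moreover have "s * real p ^ n \<le> s * real p ^ (t + 1)"
      using s p by (intro mult_left_mono power_increasing) (auto simp: t_def)
    ultimately show ?thesis by (simp add: mult_ac)
  qed
  have step: "level_mass p s n (Suc j) \<le> level_mass p s n j * c"
    if j: "j \<le> n" and c: "real p \<le> c * (real p ^ Suc j - 1)" for j c
  proof -
    have pos: "real p ^ Suc j - 1 > 0" using p one_less_power [of "real p" "Suc j"] by simp
    have "level_mass p s n (Suc j) * (real p ^ Suc j - 1)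
        = level_mass p s n j * (s * (real p ^ n - real p ^ j))"
      by (rule level_mass_Suc [OF j])
    also have "\<dots> \<le> level_mass p s n j * (c * (real p ^ Suc j - 1))"
    proof (rule mult_left_mono)
      have "s * (real p ^ n - real p ^ j) \<le> s * real p ^ n" using s by (intro mult_left_mono) auto
      with sn c show "s * (real p ^ n - real p ^ j) \<le> c * (real p ^ Suc j - 1)" by linarith
    qed (use s in \<open>simp add: level_mass_nonneg\<close>)
    also have "\<dots> = level_mass p s n j * c * (real p ^ Suc j - 1)" by (rule mult.assoc [symmetric])
    finally show ?thesis using pos by (rule mult_right_le_imp_le)
  qed
  show "k + 2 \<le> n \<Longrightarrow> level_mass p s n (k + 2) \<le> level_mass p s n 1 * (2 / 3 * (2 / 7) ^ k)"
  proof (induction k)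
    case 0
    have "0 \<le> (2 * real p + 1) * (real p - 2)" using p2 by (intro mult_nonneg_nonneg) auto
    then have "real p \<le> 2 / 3 * (real p ^ Suc 1 - 1)" by (simp add: algebra_simps)
    then show ?case using step [of 1 "2 / 3"] n by (simp add: numeral_2_eq_2)
  next
    case (Suc k)
    have "0 \<le> (real p - 2) * (2 * real p ^ 2 + 4 * real p + 1)"
      using p2 by (intro mult_nonneg_nonneg add_nonneg_nonneg) auto
    then have "7 * real p \<le> 2 * (real p ^ 3 - 1)"
      by (simp add: algebra_simps power2_eq_square power3_eq_cube)
    also have "\<dots> \<le> 2 * (real p ^ Suc (k + 2) - 1)"
      using p by (simp add: power_increasing del: power_Suc)
    finally have c: "real p \<le> 2 / 7 * (real p ^ Suc (k + 2) - 1)" by linarith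
    have "level_mass p s n (Suc (k + 2)) \<le> level_mass p s n (k + 2) * (2 / 7)"
      using Suc.prems by (intro step c) auto
    also have "\<dots> \<le> level_mass p s n 1 * (2 / 3 * (2 / 7) ^ k) * (2 / 7)"
      using Suc by (intro mult_right_mono) auto
    finally show ?case by (simp add: mult_ac)
  qed
qed

text \<open>
The number \<open>\<delta> k\<close> stands for the difference between the density of the family on level \<open>k\<close> and the
density of a star. For \<open>k < n / 2\<close> the hypothesis \<open>pair\<close>, taken \<open>T (n - k)\<close> times, absorbs the whole of
level \<open>n - k\<close> and leaves the mass \<open>R k = T k - q ^ (n - k) * T (n - k) \<ge> 0\<close> on level \<open>k\<close>. For \<open>k \<ge> 2\<close> the
hypothesis \<open>pts\<close> replaces this rest by at most \<open>T k\<close> times \<open>- \<delta> 1\<close>. What remains is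
\<open>(R 1 - \<Sum>k. T k) * \<delta> 1\<close>, summed over \<open>2 \<le> k < n / 2\<close>. Its coefficient is not negative: for \<open>n \<le> 4\<close> the sum is
empty, and for \<open>n \<ge> 5\<close> the sum is at most \<open>2 / 3 * (1 / (1 - 2 / 7)) = 14 / 15\<close> of \<open>T 1\<close> whereas \<open>R 1\<close>
is at least \<open>31 / 32\<close> of it. For \<open>n \<le> 2\<close> there are no such pairs of levels, and each term of the sum is
at most \<open>0\<close>.
\<close>

lemma weighted_deviation_le_0:
  fixes p n :: nat and s :: real and \<delta> :: "nat \<Rightarrow> real"
  assumes p: "p > 1" and s: "s > 0" "s \<le> sigma_bound p n" and n: "n > 0"
    and d1: "\<delta> 1 \<le> 0" and dn: "\<delta> n \<le> 0"
    and pair: "\<And>k. k > 0 \<Longrightarrow> 2 * k \<le> n \<Longrightarrow> real p ^ (n - k) * \<delta> k + \<delta> (n - k) \<le> 0"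
    and pts: "\<And>k. k > 0 \<Longrightarrow> 2 * k \<le> n \<Longrightarrow>
      real p ^ (n - k) * \<delta> k + (real p ^ (n - k) - 1) / (real p - 1) * \<delta> 1 \<le> 0"
  shows "(\<Sum>k=1..n. level_mass p s n k * \<delta> k) \<le> 0"
    and "(\<Sum>k=1..n. level_mass p s n k * \<delta> k) = 0 \<Longrightarrow> s < sigma_bound p n \<Longrightarrow> \<delta> 1 = 0"
proof -
  let ?T = "level_mass p s n"
  let ?S = "\<Sum>k=1..n. ?T k * \<delta> k"
  have T0: "?T k \<ge> 0" for k using s by (simp add: level_mass_nonneg)
  have T1: "?T 1 > 0"
    using s p n gbin_pos [of p 1 n] by (simp add: level_mass_def binomial_eq_0)
  (* For s strictly below the bound, C > 0 turns equality into the vanishing of \<delta> 1. *)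
  have "\<exists>C. ?S \<le> C * \<delta> 1 \<and> C \<ge> 0 \<and> (s < sigma_bound p n \<longrightarrow> C > 0)"
  proof (cases "n \<le> 2")
    case True
    then consider "n = 1" | "n = 2" using n by linarith
    then show ?thesis
    proof cases
      case 1
      then show ?thesis using T1 by (intro exI [of _ "?T 1"]) auto
    next
      case 2
      then have "?S = ?T 1 * \<delta> 1 + ?T 2 * \<delta> 2" by (simp add: numeral_2_eq_2)
      then show ?thesis using 2 T1 dn mult_nonneg_nonpos [OF T0 [of 2], of "\<delta> 2"]
        by (intro exI [of _ "?T 1"]) auto
    qed
  next
    case False
    (* A holds the lower members of the pairs (k, n - k) of levels; M is the middle level, if there is one. *)
    define A where "A = {k. 0 < k \<and> 2 * k < n}"
    define M where "M = {k. 0 < k \<and> 2 * k = n}"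
    define R where "R k = ?T k - real p ^ (n - k) * ?T (n - k)" for k
    have finA: "finite A" by (rule finite_subset [of _ "{..n}"]) (auto simp: A_def)
    have finM: "finite M" by (rule finite_subset [of _ "{..n}"]) (auto simp: M_def)
    have ratio: "\<exists>r. R k = ?T k * (1 - r) \<and> r \<le> 1 \<and> (s < sigma_bound p n \<longrightarrow> r < 1)
      \<and> (k = 1 \<and> n \<ge> 5 \<longrightarrow> r \<le> 1 / 32)" if "k \<in> A" for k
    proof -
      define d where "d = n - 2 * k"
      have d: "n = 2 * k + d" "d > 0" "k > 0" using that by (auto simp: A_def d_def)
      let ?r = "s ^ d * real p ^ ((d choose 2) + d * k) * real p ^ (n - k)"
      have "R k = ?T k * (1 - ?r)"
        using level_mass_complement [of p n k d s] p d(1) unfolding R_def by (simp add: algebra_simps)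
      then show ?thesis
        using mass_ratio_bound [OF p s d] d by (intro exI [of _ ?r]) auto
    qed
    have R0: "R k \<ge> 0" if "k \<in> A" for k
      using ratio [OF that] T0 [of k] by auto
    have RT: "R k \<le> ?T k" for k
      using T0 [of "n - k"] p by (simp add: R_def)
    have one: "1 \<in> A" using False by (simp add: A_def)
    have split: "?S = (\<Sum>k\<in>A. ?T k * \<delta> k + ?T (n - k) * \<delta> (n - k)) + (\<Sum>k\<in>M. ?T k * \<delta> k) + ?T n * \<delta> n"
    proof -
      let ?B = "(\<lambda>k. n - k) ` A"
      have "{1..n} = insert n (M \<union> (A \<union> ?B))"
      proof (intro equalityI subsetI)
        fix k assume k: "k \<in> {1..n}"
        consider "k = n" | "2 * k = n" | "2 * k < n" | "n < 2 * k" "k < n" using k by force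
        then show "k \<in> insert n (M \<union> (A \<union> ?B))"
        proof cases
          case 4
          then have "n - k \<in> A" "k = n - (n - k)" by (auto simp: A_def)
          then show ?thesis by blast
        qed (use k in \<open>auto simp: A_def M_def\<close>)
      qed (use n in \<open>auto simp: A_def M_def\<close>)
      then have "?S = ?T n * \<delta> n + (\<Sum>k\<in>M \<union> (A \<union> ?B). ?T k * \<delta> k)"
        using finA finM by (simp only:) (subst sum.insert, auto simp: A_def M_def)
      also have "(\<Sum>k\<in>M \<union> (A \<union> ?B). ?T k * \<delta> k) = (\<Sum>k\<in>M. ?T k * \<delta> k) + (\<Sum>k\<in>A \<union> ?B. ?T k * \<delta> k)"
        using finA finM by (intro sum.union_disjoint) (auto simp: A_def M_def)
      also have "(\<Sum>k\<in>A \<union> ?B. ?T k * \<delta> k) = (\<Sum>k\<in>A. ?T k * \<delta> k) + (\<Sum>k\<in>?B. ?T k * \<delta> k)"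
        using finA by (intro sum.union_disjoint) (auto simp: A_def)
      also have "(\<Sum>k\<in>?B. ?T k * \<delta> k) = (\<Sum>k\<in>A. ?T (n - k) * \<delta> (n - k))"
        by (subst sum.reindex) (auto simp: inj_on_def A_def)
      finally show ?thesis by (simp add: sum.distrib)
    qed
    have mid: "?T k * \<delta> k \<le> 0" if "k \<in> M" for k
    proof -
      have k: "k > 0" "n - k = k" using that by (auto simp: M_def)
      have "(real p ^ k + 1) * \<delta> k \<le> 0" using pair [of k] that k by (simp add: M_def algebra_simps)
      moreover have "real p ^ k + 1 > 0" by (simp add: add_nonneg_pos)
      ultimately have "\<delta> k \<le> 0" using mult_le_cancel_left_pos [of "real p ^ k + 1" "\<delta> k" 0] by simp
      then show ?thesis using T0 by (simp add: mult_nonneg_nonpos)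
    qed
    have pair_le: "?T k * \<delta> k + ?T (n - k) * \<delta> (n - k) \<le> R k * \<delta> k" if "k \<in> A" for k
    proof -
      have "?T (n - k) * (real p ^ (n - k) * \<delta> k + \<delta> (n - k)) \<le> 0"
        using that pair [of k] T0 by (intro mult_nonneg_nonpos) (auto simp: A_def)
      then show ?thesis by (simp add: R_def algebra_simps)
    qed
    have remainder_le: "R k * \<delta> k \<le> - ?T k * \<delta> 1" if "k \<in> A" for k
    proof -
      let ?Q = "real p ^ (n - k)"
      have Q: "?Q > 0" using p by simp
      have p2: "real p \<ge> 2" using p by simp
      have "?Q * \<delta> k \<le> (?Q - 1) / (real p - 1) * (- \<delta> 1)"
        using pts [of k] that by (simp add: A_def)
      also have "\<dots> \<le> ?Q * (- \<delta> 1)"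
      proof (rule mult_right_mono)
        have "?Q - 1 \<le> ?Q * (real p - 1)"
          using mult_left_mono [of 1 "real p - 1" ?Q] Q p2 by linarith
        then show "(?Q - 1) / (real p - 1) \<le> ?Q" using p by (simp add: field_simps)
      qed (use d1 in simp)
      finally have "\<delta> k \<le> - \<delta> 1" using Q by (simp only: mult_le_cancel_left_pos)
      then have "R k * \<delta> k \<le> R k * (- \<delta> 1)" using R0 [OF that] by (rule mult_left_mono)
      also have "\<dots> \<le> ?T k * (- \<delta> 1)" using RT [of k] d1 by (intro mult_right_mono) auto
      finally show ?thesis by simp
    qed
    define W where "W = (\<Sum>k\<in>A - {1}. ?T k)"
    have "?S \<le> (\<Sum>k\<in>A. R k * \<delta> k)"
    proof -
      have "(\<Sum>k\<in>A. ?T k * \<delta> k + ?T (n - k) * \<delta> (n - k)) \<le> (\<Sum>k\<in>A. R k * \<delta> k)"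
        by (intro sum_mono pair_le)
      moreover have "(\<Sum>k\<in>M. ?T k * \<delta> k) \<le> 0" by (intro sum_nonpos mid)
      moreover have "?T n * \<delta> n \<le> 0" by (intro mult_nonneg_nonpos T0 dn)
      ultimately show ?thesis unfolding split by linarith
    qed
    also have "\<dots> = R 1 * \<delta> 1 + (\<Sum>k\<in>A - {1}. R k * \<delta> k)"
      by (rule sum.remove [OF finA one])
    also have "\<dots> \<le> R 1 * \<delta> 1 + (\<Sum>k\<in>A - {1}. - ?T k * \<delta> 1)"
      by (intro add_left_mono sum_mono remainder_le) auto
    also have "\<dots> = (R 1 - W) * \<delta> 1"
      by (simp add: W_def algebra_simps sum_negf sum_distrib_left)
    finally have le: "?S \<le> (R 1 - W) * \<delta> 1" .
    obtain r where r: "R 1 = ?T 1 * (1 - r)" "r \<le> 1" "s < sigma_bound p n \<longrightarrow> r < 1"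
        "n \<ge> 5 \<longrightarrow> r \<le> 1 / 32"
      using ratio [OF one] by auto
    show ?thesis
    proof (cases "n \<ge> 5")
      case True
      have "W \<le> (\<Sum>k\<in>{2..<n}. ?T k)"
        unfolding W_def using T0 by (intro sum_mono2) (auto simp: A_def)
      also have "\<dots> = (\<Sum>j<n - 2. ?T (j + 2))"
        using True by (intro sum.reindex_bij_witness [of _ "\<lambda>j. j + 2" "\<lambda>k. k - 2"])
           (auto simp del: add_2_eq_Suc add_2_eq_Suc')
      also have "\<dots> \<le> (\<Sum>j<n - 2. ?T 1 * (2 / 3 * (2 / 7) ^ j))"
        using mass_decay [OF p s] True by (intro sum_mono) auto
      also have "\<dots> = ?T 1 * (2 / 3) * (\<Sum>j<n - 2. (2 / 7) ^ j)"
        by (simp add: sum_distrib_left mult.assoc)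
      also have "(\<Sum>j<n - 2. (2 / 7 :: real) ^ j) \<le> 7 / 5"
        by (subst sum_gp_strict) simp
      finally have W: "W \<le> ?T 1 * (14 / 15)" using T1 by simp
      have "?T 1 * (31 / 32) \<le> ?T 1 * (1 - r)" using r True T1 by (intro mult_left_mono) auto
      then have "R 1 - W > 0" unfolding r(1) using W T1 by linarith
      then show ?thesis using le by (intro exI [of _ "R 1 - W"]) auto
    next
      case False
      then have "A - {1} = {}" by (auto simp: A_def)
      then have "W = 0" unfolding W_def by (simp only: sum.empty)
      then show ?thesis using le r T1 by (intro exI [of _ "R 1"]) (auto simp: zero_le_mult_iff)
    qed
  qed
  then obtain C where C: "?S \<le> C * \<delta> 1" "C \<ge> 0" "s < sigma_bound p n \<longrightarrow> C > 0" by blast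
  show "?S \<le> 0" using C(1,2) d1 mult_nonneg_nonpos [of C "\<delta> 1"] by linarith
  show "\<delta> 1 = 0" if "?S = 0" "s < sigma_bound p n"
  proof -
    have "C * \<delta> 1 \<ge> 0" "C > 0" using C that by auto
    then show ?thesis using d1 by (simp add: zero_le_mult_iff)
  qed
qed

section \<open>Intersecting families\<close>

lemma Un_level: "U \<subseteq> Omega \<Longrightarrow> U = (\<Union>k\<le>CARD('n). U \<inter> level k)"
  for U :: "('a :: {field, finite} ^ 'n) set set"
  using vec.dim_subset_UNIV by (auto simp: level_def vec_dim_card card_cart_basis vec.dimension_def)

lemma mu_eq_sum_density:
  fixes U :: "('a :: {field, finite} ^ 'n) set set"
  assumes U: "U \<subseteq> Omega"
  shows "mu \<sigma> U = (\<Sum>k\<le>CARD('n). level_mass CARD('a) \<sigma> CARD('n) k * level_density U k)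
    / qpoch (- \<sigma>) CARD('a) CARD('n)"
proof -
  let ?q = "CARD('a)" and ?n = "CARD('n)"
  have fin: "finite A" for A :: "('a ^ 'n) set set" by (rule finite_subset [OF subset_UNIV]) simp
  have "mu \<sigma> U = (\<Sum>x\<in>(\<Union>k\<le>?n. U \<inter> level k). phi ?q \<sigma> ?n (vec.dim x))"
    unfolding mu_def using Un_level [OF U] by simp
  also have "\<dots> = (\<Sum>k\<le>?n. \<Sum>x\<in>U \<inter> level k. phi ?q \<sigma> ?n (vec.dim x))"
    by (rule sum.UNION_disjoint) (auto simp: fin level_def)
  also have "\<dots> = (\<Sum>k\<le>?n. level_mass ?q \<sigma> ?n k * level_density U k / qpoch (- \<sigma>) ?q ?n)"
  proof (intro sum.cong refl)
    fix k assume "k \<in> {..?n}"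
    then have k: "k \<le> ?n" by simp
    have "real (card (level k :: ('a ^ 'n) set set)) = gbin ?q ?n k" by (rule card_level [OF k])
    moreover have "gbin ?q ?n k > 0" using card_field_gt_1 [where 'a = 'a] k by (intro gbin_pos) auto
    ultimately have "card (U \<inter> level k) = gbin ?q ?n k * level_density U k"
      by (simp add: level_density_def)
    moreover have "(\<Sum>x\<in>U \<inter> level k. phi ?q \<sigma> ?n (vec.dim x)) = (\<Sum>x\<in>U \<inter> level k. phi ?q \<sigma> ?n k)"
      by (intro sum.cong refl) (auto simp: level_def)
    ultimately show "(\<Sum>x\<in>U \<inter> level k. phi ?q \<sigma> ?n (vec.dim x))
        = level_mass ?q \<sigma> ?n k * level_density U k / qpoch (- \<sigma>) ?q ?n"
      by (simp add: phi_def level_mass_def)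
  qed
  finally show ?thesis by (simp add: sum_divide_distrib)
qed

definition star_density :: "real \<Rightarrow> nat \<Rightarrow> nat \<Rightarrow> real" where
  "star_density q n k = (q ^ k - 1) / (q ^ n - 1)"

text \<open>
The partitions used are, in this order: the whole space alone, all lines, a partial spread with its
complementary subspace \<open>Y\<close>, and a partial spread with the lines of \<open>Y\<close>. For \<open>2 * k = n\<close> the subspace \<open>Y\<close>
is one more member of the spread.
\<close>

lemma density_bounds:
  fixes U :: "('a :: {field, finite} ^ 'n) set set"
  assumes int: "intersecting U"
  defines "q \<equiv> real CARD('a)" and "n \<equiv> CARD('n)"
  shows "level_density U n \<le> 1"
    and "(q ^ n - 1) / (q - 1) * level_density U 1 \<le> 1"
    and "k > 0 \<Longrightarrow> 2 * k \<le> n \<Longrightarrow> q ^ (n - k) * level_density U k + level_density U (n - k) \<le> 1"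
    and "k > 0 \<Longrightarrow> 2 * k \<le> n \<Longrightarrow>
      q ^ (n - k) * level_density U k + (q ^ (n - k) - 1) / (q - 1) * level_density U 1 \<le> 1"
proof -
  have q1: "q > 1" using card_field_gt_1 [where 'a = 'a] by (simp add: q_def)
  have fin: "finite A" for A :: "('a ^ 'n) set set" by (rule finite_subset [OF subset_UNIV]) simp
  have dimV: "vec.dim (UNIV :: ('a ^ 'n) set) = n" by (simp add: n_def card_cart_basis)
  have lines: "(\<Sum>x\<in>{x \<in> level 1. x \<subseteq> Y}. level_density U (vec.dim x)) =
      (q ^ vec.dim Y - 1) / (q - 1) * level_density U 1"
    if Y: "vec.subspace Y" for Y :: "('a ^ 'n) set"
  proof -
    have "real (card {x \<in> level 1. x \<subseteq> Y} * (CARD('a) - 1)) = real (CARD('a) ^ vec.dim Y - 1)"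
      by (simp only: card_lines [OF Y])
    then have "real (card {x \<in> level 1. x \<subseteq> Y}) * (q - 1) = q ^ vec.dim Y - 1"
      using card_field_gt_1 [where 'a = 'a] by (simp add: q_def of_nat_diff)
    then have "real (card {x \<in> level 1. x \<subseteq> Y}) = (q ^ vec.dim Y - 1) / (q - 1)"
      using q1 by (simp add: field_simps)
    moreover have "(\<Sum>x\<in>{x \<in> level 1. x \<subseteq> Y}. level_density U (vec.dim x)) =
        (\<Sum>x\<in>{x \<in> level 1. x \<subseteq> Y}. level_density U 1)"
      by (intro sum.cong refl) (auto simp: level_def)
    ultimately show ?thesis by simp
  qed
  show "level_density U n \<le> 1"
    using sum_density_le_1 [OF int, of "{UNIV}"] dimV by (simp add: Omega_def)
  show "(q ^ n - 1) / (q - 1) * level_density U 1 \<le> 1"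
  proof -
    have "(\<Sum>x\<in>{x \<in> level 1. x \<subseteq> (UNIV :: ('a ^ 'n) set)}. level_density U (vec.dim x)) \<le> 1"
    proof (rule sum_density_le_1 [OF int])
      show "{x \<in> level 1. x \<subseteq> (UNIV :: ('a ^ 'n) set)} \<subseteq> Omega" by (auto simp: level_def)
    qed (use lines_Int_trivial in blast)
    then show ?thesis using lines [OF vec.subspace_UNIV] dimV by simp
  qed
  assume k: "k > 0" "2 * k \<le> n"
  then have km: "(n - k) + k = CARD('n)" "k \<le> n - k" by (auto simp: n_def)
  obtain P and Y :: "('a ^ 'n) set" where Y: "vec.subspace Y" "vec.dim Y = n - k"
    and cP: "card P = CARD('a) ^ (n - k)"
    and P: "\<And>x. x \<in> P \<Longrightarrow> vec.subspace x \<and> vec.dim x = k \<and> x \<inter> Y = {0}"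
    and PP: "\<And>x y. x \<in> P \<Longrightarrow> y \<in> P \<Longrightarrow> x \<noteq> y \<Longrightarrow> x \<inter> y = {0}"
    using exists_partial_spread [OF km k(1)] by metis
  have sP: "(\<Sum>x\<in>P. level_density U (vec.dim x)) = q ^ (n - k) * level_density U k"
  proof -
    have "(\<Sum>x\<in>P. level_density U (vec.dim x)) = (\<Sum>x\<in>P. level_density U k)"
      by (intro sum.cong refl) (simp add: P)
    then show ?thesis by (simp add: cP q_def)
  qed
  have nonzero: "x \<noteq> {0}" if "x \<in> P" for x using P [OF that] k(1) vec.dim_eq_0 [of x] by auto
  show "q ^ (n - k) * level_density U k + level_density U (n - k) \<le> 1"
  proof -
    have "Y \<notin> P" using P [of Y] nonzero [of Y] by auto
    then have "(\<Sum>x\<in>insert Y P. level_density U (vec.dim x)) = level_density U (n - k) + q ^ (n - k) * level_density U k"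
      using fin by (simp add: sP Y)
    moreover have "(\<Sum>x\<in>insert Y P. level_density U (vec.dim x)) \<le> 1"
      by (rule sum_density_le_1 [OF int]) (use P PP Y in \<open>auto simp: Omega_def Int_commute\<close>)
    ultimately show ?thesis by simp
  qed
  show "q ^ (n - k) * level_density U k + (q ^ (n - k) - 1) / (q - 1) * level_density U 1 \<le> 1"
  proof -
    let ?L = "{x \<in> level 1. x \<subseteq> Y}"
    have cross: "x \<inter> z = {0}" if "x \<in> P" "z \<in> ?L" for x z
    proof -
      have "x \<inter> z \<subseteq> {0}" using P [OF that(1)] that(2) by blast
      moreover have "0 \<in> x \<inter> z"
        using P [OF that(1)] that(2) vec.subspace_0 by (auto simp: level_def Omega_def)
      ultimately show ?thesis by blast
    qed
    have disj: "P \<inter> ?L = {}" using cross nonzero by blast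
    have "(\<Sum>x\<in>P \<union> ?L. level_density U (vec.dim x)) \<le> 1"
    proof (rule sum_density_le_1 [OF int])
      show "P \<union> ?L \<subseteq> Omega" using P by (auto simp: Omega_def level_def)
      fix x y assume xy: "x \<in> P \<union> ?L" "y \<in> P \<union> ?L" "x \<noteq> y"
      consider "x \<in> P" "y \<in> P" | "x \<in> P" "y \<in> ?L" | "x \<in> ?L" "y \<in> P" | "x \<in> ?L" "y \<in> ?L"
        using xy by blast
      then show "x \<inter> y = {0}"
      proof cases
        case 1 then show ?thesis using PP xy(3) by blast
      next
        case 2 then show ?thesis by (rule cross)
      next
        case 3 then show ?thesis using cross [of y x] by (simp only: Int_commute)
      next
        case 4 then show ?thesis using lines_Int_trivial xy(3) by blast
      qed
    qed
    also have "(\<Sum>x\<in>P \<union> ?L. level_density U (vec.dim x)) =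
        (\<Sum>x\<in>P. level_density U (vec.dim x)) + (\<Sum>x\<in>?L. level_density U (vec.dim x))"
      by (rule sum.union_disjoint [OF fin fin disj])
    finally show ?thesis by (simp only: sP lines [OF Y(1)] Y(2))
  qed
qed

text \<open>
Equality in the measure, for \<open>\<sigma>\<close> strictly below the bound, forces the family to have the density
\<open>(q - 1) / (q ^ n - 1) > 0\<close> of a star on the level of lines.
\<close>

lemma mu_intersecting:
  fixes U :: "('a :: {field, finite} ^ 'n) set set"
  assumes s: "\<sigma> > 0" "\<sigma> \<le> sigma_bound CARD('a) CARD('n)"
    and U: "U \<subseteq> Omega" "intersecting U"
  shows "mu \<sigma> U \<le> \<sigma> / (1 + \<sigma>)"
    and "mu \<sigma> U = \<sigma> / (1 + \<sigma>) \<Longrightarrow> \<sigma> < sigma_bound CARD('a) CARD('n) \<Longrightarrow> U \<inter> level 1 \<noteq> {}"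
proof -
  define q where "q = real CARD('a)"
  define n where "n = CARD('n)"
  have q1: "q > 1" using card_field_gt_1 [where 'a = 'a] by (simp add: q_def)
  have n0: "n > 0" by (simp add: n_def)
  have qn: "q ^ n > 1" using q1 n0 by (simp add: one_less_power)
  let ?T = "level_mass q \<sigma> n" and ?Z = "qpoch (- \<sigma>) q n"
  define \<delta> where "\<delta> k = level_density U k - star_density q n k" for k
  note bounds = density_bounds [OF U(2), folded q_def n_def]
  have Z: "?Z > 0" unfolding qpoch_uminus using s q1 by (intro prod_pos) (simp add: add_pos_nonneg)
  have d0: "level_density U 0 = 0"
  proof -
    have "U \<inter> level 0 = {}"
    proof (rule ccontr)
      assume "U \<inter> level 0 \<noteq> {}"
      then obtain x where x: "x \<in> U" "vec.subspace x" "x \<subseteq> {0}"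
        by (auto simp: level_def Omega_def)
      then have "x \<inter> x = {0}" using vec.subspace_0 by blast
      then show False using U(2) x(1) by (auto simp: intersecting_def)
    qed
    then show ?thesis by (simp add: level_density_def)
  qed
  have "mu \<sigma> U * ?Z = (\<Sum>k\<le>n. ?T k * level_density U k)"
    using mu_eq_sum_density [OF U(1), of \<sigma>, folded q_def n_def] Z by simp
  also have "\<dots> = (\<Sum>k=1..n. ?T k * level_density U k)"
    unfolding atMost_atLeast0 by (subst sum.atLeast_Suc_atMost) (simp_all add: d0)
  also have "\<dots> = (\<Sum>k=1..n. ?T k * \<delta> k) + (\<Sum>k=1..n. ?T k * star_density q n k)"
    by (simp add: \<delta>_def algebra_simps sum.distrib [symmetric])
  also have "(\<Sum>k=1..n. ?T k * star_density q n k) = \<sigma> / (1 + \<sigma>) * ?Z"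
    unfolding star_density_def qpoch_uminus by (rule sum_level_mass_star [OF q1 s(1) n0])
  finally have mu: "(mu \<sigma> U - \<sigma> / (1 + \<sigma>)) * ?Z = (\<Sum>k=1..n. ?T k * \<delta> k)"
    by (simp add: algebra_simps)
  have star_n: "star_density q n n = 1" using qn by (simp add: star_density_def)
  have star_1: "(q ^ m - 1) / (q - 1) * star_density q n 1 = (q ^ m - 1) / (q ^ n - 1)" for m
    using q1 by (simp add: star_density_def)
  have star_pair: "q ^ (n - k) * star_density q n k + star_density q n (n - k) = 1" if "k \<le> n" for k
  proof -
    have "q ^ (n - k) * (q ^ k - 1) + (q ^ (n - k) - 1) = q ^ n - 1"
      using that by (simp add: algebra_simps power_add [symmetric])
    then show ?thesis using qn by (simp add: star_density_def add_divide_distrib [symmetric])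
  qed
  have dn: "\<delta> n \<le> 0" using bounds(1) star_n by (simp add: \<delta>_def)
  have d1: "\<delta> 1 \<le> 0"
  proof -
    have "(q ^ n - 1) / (q - 1) * star_density q n 1 = 1"
      unfolding star_1 using qn by simp
    with bounds(2) have "(q ^ n - 1) / (q - 1) * \<delta> 1 \<le> (q ^ n - 1) / (q - 1) * 0"
      by (simp only: \<delta>_def right_diff_distrib mult_zero_right)
    moreover have "(q ^ n - 1) / (q - 1) > 0" using qn q1 by simp
    ultimately show ?thesis by (simp only: mult_le_cancel_left_pos)
  qed
  have pair: "q ^ (n - k) * \<delta> k + \<delta> (n - k) \<le> 0" if "k > 0" "2 * k \<le> n" for k
    using bounds(3) [OF that] star_pair [of k] that
    unfolding \<delta>_def right_diff_distrib by linarith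
  have pts: "q ^ (n - k) * \<delta> k + (q ^ (n - k) - 1) / (q - 1) * \<delta> 1 \<le> 0"
    if "k > 0" "2 * k \<le> n" for k
    using bounds(4) [OF that] star_pair [of k] star_1 [of "n - k"] that
    unfolding \<delta>_def right_diff_distrib star_density_def [of q n "n - k"] by linarith
  note core = weighted_deviation_le_0 [OF card_field_gt_1 s, of \<delta>, folded q_def n_def,
      OF n0 d1 dn pair pts]
  have "(mu \<sigma> U - \<sigma> / (1 + \<sigma>)) * ?Z \<le> 0"
    unfolding mu by (rule core(1))
  then show "mu \<sigma> U \<le> \<sigma> / (1 + \<sigma>)" using Z by (simp add: mult_le_0_iff)
  show "U \<inter> level 1 \<noteq> {}" if "mu \<sigma> U = \<sigma> / (1 + \<sigma>)" "\<sigma> < sigma_bound CARD('a) CARD('n)"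
  proof -
    have "(\<Sum>k=1..n. ?T k * \<delta> k) = 0" using mu that(1) by simp
    then have "\<delta> 1 = 0" using core(2) that(2) by (simp add: n_def)
    then have "level_density U 1 = (q - 1) / (q ^ n - 1)" by (simp add: \<delta>_def star_density_def)
    also have "\<dots> > 0" using q1 qn by simp
    finally show ?thesis by (auto simp: level_density_def)
  qed
qed

theorem theorem1:
  fixes U :: "('a :: {field, finite} ^ 'n) set set" and \<sigma> :: real
  assumes "\<sigma> > 0"
    and "\<sigma> \<le> sigma_bound CARD('a) CARD('n)"
    and "U \<subseteq> Omega"
    and "intersecting U"
  shows "mu \<sigma> U \<le> \<sigma> / (1 + \<sigma>) \<and>
    (mu \<sigma> U = \<sigma> / (1 + \<sigma>) \<and> \<sigma> < sigma_bound CARD('a) CARD('n) \<longrightarrow>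
      (\<exists>y\<in>Omega. vec.dim y = 1 \<and> U = {x \<in> Omega. y \<subseteq> x}))"
proof (intro conjI impI)
  show "mu \<sigma> U \<le> \<sigma> / (1 + \<sigma>)" by (rule mu_intersecting(1) [OF assms])
  assume eq: "mu \<sigma> U = \<sigma> / (1 + \<sigma>) \<and> \<sigma> < sigma_bound CARD('a) CARD('n)"
  then have "U \<inter> level 1 \<noteq> {}" using mu_intersecting(2) [OF assms] by blast
  then obtain y where yU: "y \<in> U" and y: "vec.subspace y" "vec.dim y = 1"
    by (auto simp: level_def Omega_def)
  let ?W = "{x \<in> Omega. y \<subseteq> x}"
  have "y \<noteq> {0}" using y(2) by auto
  then have W: "intersecting ?W"
    using y(1) vec.subspace_0 by (fastforce simp: intersecting_def)
  have UW: "U \<subseteq> ?W"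
  proof
    fix x assume x: "x \<in> U"
    then have sub: "vec.subspace x" using assms(3) by (auto simp: Omega_def)
    have "x \<inter> y \<noteq> {0}" using assms(4) x yU by (auto simp: intersecting_def)
    then obtain v where v: "v \<in> x" "v \<in> y" "v \<noteq> 0"
      using sub y(1) vec.subspace_0 by blast
    have "vec.span {v} = y"
      using v y by (intro span_eq_line) (auto simp: level_def Omega_def)
    then have "y \<subseteq> x" using vec.span_minimal [of "{v}" x] v(1) sub by auto
    then show "x \<in> ?W" using x assms(3) by auto
  qed
  have fin: "finite A" for A :: "('a ^ 'n) set set" by (rule finite_subset [OF subset_UNIV]) simp
  have pos: "phi CARD('a) \<sigma> CARD('n) k > 0" for k
    unfolding phi_def qpoch_uminus using assms(1)
    by (intro divide_pos_pos mult_pos_pos prod_pos) (auto simp: add_pos_nonneg)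
  (* The star of y is itself intersecting, so it has no more measure than its subset U. *)
  have "mu \<sigma> ?W \<le> mu \<sigma> U"
    using mu_intersecting(1) [OF assms(1,2) _ W] eq by auto
  moreover have "mu \<sigma> ?W = mu \<sigma> U + mu \<sigma> (?W - U)"
    unfolding mu_def using sum.subset_diff [OF UW fin] by (simp add: add.commute)
  ultimately have "mu \<sigma> (?W - U) \<le> 0" by simp
  moreover have "mu \<sigma> (?W - U) > 0" if "?W - U \<noteq> {}"
    unfolding mu_def by (rule sum_pos [OF fin that pos])
  ultimately have "?W - U = {}" by linarith
  then show "\<exists>y\<in>Omega. vec.dim y = 1 \<and> U = {x \<in> Omega. y \<subseteq> x}"
    using UW y by (intro bexI [of _ y]) (auto simp: Omega_def)
qed

end
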